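(* Suppose the total batch size satisfies $S\sim\mathrm{Binomial}(N,\alpha)$, with each customer independently assigned entry queue $j$ with probability $p_j$. Let $t\ge0$, $v\in\{2,\dots,J\}$, and let $n_1,\dots,n_v$ be non-negative integers with $n_v\ge1$. Then $$P\big[\mathbf{N}(t)=(n_1,\dots,n_v,0,\dots,0)\big]=\sum_{i_1=0}^{n_1}\cdots\sum_{i_{v-1}=0}^{n_{v-1}}\ \sum_{i_v=1}^{n_v}\Big[\frac{i_v}{n_v}\,P\big[\mathbf{N}(t)=(n_1-i_1,\dots,n_v-i_v,0,\dots,0)\big]\,\mathbf{1}_{\{\sum_{j=1}^v i_j\le N\}}$$ $$\cdot\int_0^t\lambda(\tau)\,\frac{N!}{\big(N-\sum_{k=1}^v i_k\big)!}\Big(1-\alpha\sum_{k=1}^J q_k(t-\tau)\Big)^{N-\sum_{k=1}^v i_k}\ \prod_{k=1}^v\frac{(\alpha q_k(t-\tau))^{i_k}}{i_k!}\,d\tau\Big],$$ where terms with $\sum_{j=1}^v i_j>N$ are interpreted as $0$, and $0^0=1$.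
   Context: Consider an open network of $J$ infinite server queues, indexed $1,\dots,J$, empty at time $0$. Batches arrive at the points $T_1,T_2,\dots$ of a non-homogeneous Poisson process on $[0,\infty)$ with rate function $\lambda(t)\ge 0$ (measurable, with $\int_0^t\lambda(\tau)\,d\tau<\infty$ for all $t$). At time $T_i$, $\Sigma_{ij}$ customers arrive at queue $j$, for $j=1,\dots,J$. The vectors $\mathbf{\Sigma}_i=(\Sigma_{i1},\dots,\Sigma_{iJ})$ are i.i.d. (and independent of the arrival times), with the same distribution as a generic vector $\mathbf{S}=(S_1,\dots,S_J)$ with non-negative integer components. It is assumed that $\mathbb{E}\big[\prod_{j=1}^J z_j^{S_j}\big]=G_S\big(\sum_{j=1}^J p_jz_j\big)$, where $p_j\ge0$, $\sum_j p_j=1$, and $G_S(z)=\mathbb{E}[z^S]$ is the probability generating function of a univariate non-negative integer-valued random variable $S$ (the total batch size). The $\ell$th customer entering queue $j$ at time $T_i$ carries a stochastic process $X^j_{i,\ell}(t)$, $t\ge 0$, where $X^j_{i,\ell}(t)=k\in\{1,\dots,J\}$ means that the customer is in queue $k$ at time $T_i+t$ (and $X^j_{i,\ell}(t)\notin\{1,\dots,J\}$ if the customer has left the network). These processes are mutually independent and independent of the arrival times and batch sizes (conditionally on the node of entry), with $P(X^j_{i,\ell}(t)=k)=q^j_k(t)$ (measurable in $t$). Put $q_k(t)=\sum_{j=1}^J p_j\,q^j_k(t)$, the probability that a customer is in queue $k$ a time $t$ after arrival. $\mathbf{N}(t)=(N_1(t),\dots,N_J(t))$, where $N_k(t)$ is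 the number of customers in queue $k$ at time $t$. In the vectors $(\cdot,\dots,\cdot,0,\dots,0)$, entries $v+1,\dots,J$ are zero. $\mathrm{Binomial}(N,\alpha)$ has $N$ a positive integer (not to be confused with $\mathbf{N}(t)$) and $\alpha\in[0,1]$.
   Formalization: Each customer's process is additionally assumed jointly measurable in time and outcome with respect to its own generated sigma-algebra (automatic for right-continuous paths); without this, a process tied to its arrival time on null events at each fixed t violates the formula. *)

theory Defs
  imports "HOL-Probability.Probability"
begin

text \<open>
  Queues are numbered \<open>1, \<dots>, J\<close>; batches and the customers within a batch are numbered from \<open>0\<close>.
  A process path takes values in \<^typ>\<open>nat\<close>, and a value outside \<open>{1..J}\<close> means that the customer
  has left the network.
\<close>

definition arrivals :: "(nat \<Rightarrow> 'w \<Rightarrow> ereal) \<Rightarrow> real \<Rightarrow> real \<Rightarrow> 'w \<Rightarrow> nat" where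
  "arrivals T s t \<omega> = card {i. ereal s < T i \<omega> \<and> T i \<omega> \<le> ereal t}"

text \<open>
  \<open>T i \<omega> = \<infinity>\<close> means that there are at most \<open>i\<close> arrivals; this has positive probability when
  \<open>\<lambda>\<close> is integrable over \<open>[0, \<infinity>)\<close>. The third and fourth conditions say that there is
  no arrival at time \<open>0\<close> and that there are finitely many in bounded time (the latter is not implied
  by the law of \<^const>\<open>arrivals\<close>, since \<^const>\<open>card\<close> is \<open>0\<close> on infinite sets). The law of an
  increment is written out because \<^const>\<open>poisson_pmf\<close> is specified for positive rates only.
\<close>

definition poisson_arrival_times ::
    "'w measure \<Rightarrow> (real \<Rightarrow> real) \<Rightarrow> (nat \<Rightarrow> 'w \<Rightarrow> ereal) \<Rightarrow> bool" where
  "poisson_arrival_times M lam T \<longleftrightarrow>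
     (\<forall>i. T i \<in> borel_measurable M) \<and>
     (\<forall>\<omega>\<in>space M. incseq (\<lambda>i. T i \<omega>)) \<and>
     (AE \<omega> in M. \<forall>i. 0 < T i \<omega>) \<and>
     (AE \<omega> in M. \<forall>t. finite {i. T i \<omega> \<le> ereal t}) \<and>
     (\<forall>s t. 0 \<le> s \<and> s \<le> t \<longrightarrow> (\<forall>m.
        Sigma_Algebra.measure M {\<omega> \<in> space M. arrivals T s t \<omega> = m} =
          (LINT \<tau>:{s<..t}|lborel. lam \<tau>) ^ m / fact m * exp (- (LINT \<tau>:{s<..t}|lborel. lam \<tau>)))) \<and>
     (\<forall>s :: nat \<Rightarrow> real. 0 \<le> s 0 \<and> incseq s \<longrightarrow>
        prob_space.indep_vars M (\<lambda>_. count_space UNIV) (\<lambda>r. arrivals T (s r) (s (Suc r))) UNIV)"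

definition pgf :: "nat pmf \<Rightarrow> real \<Rightarrow> real" where
  "pgf B z = measure_pmf.expectation B (\<lambda>s. z ^ s)"

datatype source = Arrivals | Batch nat | Customer nat nat nat

definition path_algebra :: "'w measure \<Rightarrow> (real \<Rightarrow> 'w \<Rightarrow> nat) \<Rightarrow> 'w measure" where
  "path_algebra M Y =
     vimage_algebra (space M) (\<lambda>\<omega>. \<lambda>u\<in>{0..}. Y u \<omega>) (PiM {0..} (\<lambda>_. count_space UNIV))"

definition batch_vector :: "nat \<Rightarrow> (nat \<Rightarrow> nat \<Rightarrow> 'w \<Rightarrow> nat) \<Rightarrow> nat \<Rightarrow> 'w \<Rightarrow> nat \<Rightarrow> nat" where
  "batch_vector J Sig i \<omega> = (\<lambda>j\<in>{1..J}. Sig i j \<omega>)"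

fun source_algebra ::
    "'w measure \<Rightarrow> nat \<Rightarrow> (nat \<Rightarrow> 'w \<Rightarrow> ereal) \<Rightarrow> (nat \<Rightarrow> nat \<Rightarrow> 'w \<Rightarrow> nat) \<Rightarrow>
     (nat \<Rightarrow> nat \<Rightarrow> nat \<Rightarrow> real \<Rightarrow> 'w \<Rightarrow> nat) \<Rightarrow> source \<Rightarrow> 'w measure" where
  "source_algebra M J T Sig X Arrivals =
     vimage_algebra (space M) (\<lambda>\<omega> i. T i \<omega>) (PiM UNIV (\<lambda>_. borel))"
| "source_algebra M J T Sig X (Batch i) =
     vimage_algebra (space M) (batch_vector J Sig i) (PiM {1..J} (\<lambda>_. count_space UNIV))"
| "source_algebra M J T Sig X (Customer i j l) = path_algebra M (X i j l)"

text \<open>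
  \<open>T i\<close> is the time of batch \<open>i\<close>, \<open>Sig i j\<close> the number of its customers that enter at queue \<open>j\<close>,
  and \<open>X i j l u\<close> the position of the \<open>l\<close>-th of these customers a time \<open>u\<close> after arrival.
  \<open>D\<close> is the law of the generic batch vector \<open>(S\<^sub>1, \<dots>, S\<^sub>J)\<close> and \<open>B\<close> the law of the total batch
  size \<open>S\<close>. The assumption \<open>batch_pgf\<close> says that the customers of a batch choose their entry
  queues independently, queue \<open>j\<close> with probability \<open>p j\<close>.

  Joint measurability in \<open>path_measurable\<close> is with respect to the sigma-algebra generated by the
  process itself (automatic for right-continuous paths). Joint measurability with respect to \<open>M\<close>
  would not suffice: for \<open>U\<close> uniform on \<open>[0, 1]\<close>, the sigma-algebra generated by the process
  \<open>u \<mapsto> 1 if u = U, else 0\<close> is trivial up to null sets, hence independent of \<open>U\<close>, but its value at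
  the random time \<open>U\<close> is always \<open>1\<close>.
\<close>

locale batch_network = prob_space M
  for M :: "'w measure" +
  fixes J :: nat
    and lam :: "real \<Rightarrow> real"
    and T :: "nat \<Rightarrow> 'w \<Rightarrow> ereal"
    and Sig :: "nat \<Rightarrow> nat \<Rightarrow> 'w \<Rightarrow> nat"
    and X :: "nat \<Rightarrow> nat \<Rightarrow> nat \<Rightarrow> real \<Rightarrow> 'w \<Rightarrow> nat"
    and D :: "(nat \<Rightarrow> nat) measure"
    and B :: "nat pmf"
    and p :: "nat \<Rightarrow> real"
    and q :: "nat \<Rightarrow> nat \<Rightarrow> real \<Rightarrow> real"
  assumes rate_nonneg: "\<And>\<tau>. 0 \<le> \<tau> \<Longrightarrow> 0 \<le> lam \<tau>"
    and rate_measurable: "set_borel_measurable borel {0..} lam"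
    and rate_integrable: "\<And>t. 0 \<le> t \<Longrightarrow> set_integrable lborel {0..t} lam"
    and arrival_times: "poisson_arrival_times M lam T"
    and batch_measurable:
      "\<And>i j. j \<in> {1..J} \<Longrightarrow> Sig i j \<in> measurable M (count_space UNIV)"
    and batch_law:
      "\<And>i. distr M (PiM {1..J} (\<lambda>_. count_space UNIV)) (batch_vector J Sig i) = D"
    and entry_prob_nonneg: "\<And>j. j \<in> {1..J} \<Longrightarrow> 0 \<le> p j"
    and entry_prob_sum: "(\<Sum>j=1..J. p j) = 1"
    and batch_pgf:
      "\<And>z. (\<And>j. j \<in> {1..J} \<Longrightarrow> 0 \<le> z j \<and> z j \<le> 1) \<Longrightarrow>
         (LINT S|D. (\<Prod>j=1..J. z j ^ S j)) = pgf B (\<Sum>j=1..J. p j * z j)"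
    and position_measurable:
      "\<And>i j l u. j \<in> {1..J} \<Longrightarrow> 0 \<le> u \<Longrightarrow> X i j l u \<in> measurable M (count_space UNIV)"
    and path_measurable:
      "\<And>i j l. j \<in> {1..J} \<Longrightarrow>
         (\<lambda>(u, \<omega>). X i j l u \<omega>)
           \<in> measurable (restrict_space borel {0..} \<Otimes>\<^sub>M path_algebra M (X i j l)) (count_space UNIV)"
    and position_prob:
      "\<And>i j l k u. j \<in> {1..J} \<Longrightarrow> k \<in> {1..J} \<Longrightarrow> 0 \<le> u \<Longrightarrow>
         prob {\<omega> \<in> space M. X i j l u \<omega> = k} = q j k u"
    and position_prob_measurable:
      "\<And>j k. j \<in> {1..J} \<Longrightarrow> k \<in> {1..J} \<Longrightarrow> set_borel_measurable borel {0..} (q j k)"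
    and sources_indep:
      "indep_sets (\<lambda>s. sets (source_algebra M J T Sig X s))
         ({Arrivals} \<union> range Batch \<union> {Customer i j l | i j l. j \<in> {1..J}})"

text \<open>\<open>q\<^sub>k(u)\<close>: the probability that a customer is in queue \<open>k\<close> a time \<open>u\<close> after arrival.\<close>

definition occupancy ::
    "nat \<Rightarrow> (nat \<Rightarrow> real) \<Rightarrow> (nat \<Rightarrow> nat \<Rightarrow> real \<Rightarrow> real) \<Rightarrow> nat \<Rightarrow> real \<Rightarrow> real" where
  "occupancy J p q k u = (\<Sum>j=1..J. p j * q j k u)"

definition queue_length ::
    "nat \<Rightarrow> (nat \<Rightarrow> 'w \<Rightarrow> ereal) \<Rightarrow> (nat \<Rightarrow> nat \<Rightarrow> 'w \<Rightarrow> nat) \<Rightarrow>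
     (nat \<Rightarrow> nat \<Rightarrow> nat \<Rightarrow> real \<Rightarrow> 'w \<Rightarrow> nat) \<Rightarrow> nat \<Rightarrow> real \<Rightarrow> 'w \<Rightarrow> nat" where
  "queue_length J T Sig X k t \<omega> =
     card {(i, j, l). T i \<omega> \<le> ereal t \<and> j \<in> {1..J} \<and> l < Sig i j \<omega> \<and>
                      X i j l (t - real_of_ereal (T i \<omega>)) \<omega> = k}"

definition state_prob ::
    "'w measure \<Rightarrow> nat \<Rightarrow> (nat \<Rightarrow> 'w \<Rightarrow> ereal) \<Rightarrow> (nat \<Rightarrow> nat \<Rightarrow> 'w \<Rightarrow> nat) \<Rightarrow>
     (nat \<Rightarrow> nat \<Rightarrow> nat \<Rightarrow> real \<Rightarrow> 'w \<Rightarrow> nat) \<Rightarrow> real \<Rightarrow> (nat \<Rightarrow> nat) \<Rightarrow> real" where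
  "state_prob M J T Sig X t n =
     Sigma_Algebra.measure M {\<omega> \<in> space M. \<forall>k\<in>{1..J}. queue_length J T Sig X k t \<omega> = n k}"

text \<open>\<open>(n\<^sub>1, \<dots>, n\<^sub>v, 0, \<dots>, 0)\<close>\<close>

definition zero_beyond :: "nat \<Rightarrow> (nat \<Rightarrow> nat) \<Rightarrow> nat \<Rightarrow> nat" where
  "zero_beyond v n k = (if k \<le> v then n k else 0)"

end

theory Submission
  imports Defs
begin

text \<open>
  The identity is a recursion of Panjer type, and it comes from the generating function of the queue
  lengths. Given the arrival times, different batches act independently, and a batch that arrived at
  \<open>\<tau>\<close> contributes to the queues at time \<open>t\<close> a random vector whose generating function
  \<open>G\<^sub>\<tau>(z)\<close> depends only on its age \<open>t - \<tau>\<close>. Averaging the product of these factors over the Poisson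
  points gives

  \<open>\<Phi>(z) = E[\<Prod>\<^sub>k z\<^sub>k\<^bsup>N\<^sub>k(t)\<^esup>] = exp (\<integral>\<^sub>0\<^sup>t \<lambda>(\<tau>) (G\<^sub>\<tau>(z) - 1) d\<tau>)\<close>,

  which is \<open>queue_lengths_pgf\<close>. Setting \<open>z\<^sub>k = 0\<close> for \<open>k > v\<close> keeps exactly the states with the queues
  beyond \<open>v\<close> empty. For binomial batches \<open>G\<^sub>\<tau>\<close> is the \<open>N\<close>-th power of an affine function of \<open>z\<close>, so the
  exponent is a polynomial \<open>H(z) = - \<Lambda> + \<Sum>\<^sub>i c\<^sub>i z\<^bsup>i\<^esup>\<close> whose coefficients \<open>c\<^sub>i\<close> are the integrals in the
  statement (\<open>log_pgf_expansion\<close>). From \<open>\<Phi> = exp H\<close> follows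
  \<open>z\<^sub>v \<partial>\<^sub>v\<Phi> = (z\<^sub>v \<partial>\<^sub>vH) \<Phi>\<close>, and comparing coefficients of \<open>z\<^bsup>n\<^esup>\<close> gives
  \<open>n\<^sub>v P(n) = \<Sum>\<^sub>i i\<^sub>v c\<^sub>i P(n - i)\<close>, the theorem up to division by \<open>n\<^sub>v\<close>.

  Two points need care. The Poisson formula \<open>E[\<Prod>\<^sub>i g(T\<^sub>i)] = exp (\<integral> \<lambda> (g - 1))\<close> follows from independent
  increments when \<open>g\<close> is a step function; the transition probabilities are merely measurable, so it has
  to be carried to all Borel functions with values in \<open>[0, 1]\<close>. Both sides respect pointwise limits of
  such functions, and iterated limits starting from continuous functions reach all of them
  (\<open>baire_borel\<close>). Secondly, coefficients of series in several variables are compared one variable at a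
  time: \<open>exp_polynomial_recursion\<close> treats \<open>z\<^sub>v\<close>, the variable of differentiation, and
  \<open>pgf_coefficient_identity\<close> treats the other variables by induction.
\<close>

section \<open>Coefficients of generating functions\<close>

text \<open>
  Only arguments in \<open>[0, 1)\<close> are available, because marks are probabilities. Dividing by
  \<open>x\<close> moves the next coefficient to the front, where it is the right-hand limit at \<open>0\<close> of a function that
  vanishes for \<open>x > 0\<close>.
\<close>

lemma power_series_zero_on_unit_interval:
  fixes a :: "nat \<Rightarrow> real"
  assumes "\<And>x. 0 \<le> x \<Longrightarrow> x < 1 \<Longrightarrow> (\<lambda>m. a m * x ^ m) sums 0"
  shows "a m = 0"
  using assms
proof (induction m arbitrary: a)
  case 0
  from "0.prems"[of 0] have "(\<lambda>m. a m * 0 ^ m) sums 0" by simp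
  then show ?case
    using powser_sums_zero[of a] sums_unique2 by blast
next
  case (Suc m)
  define f where "f x = (\<Sum>m. a (Suc m) * x ^ m)" for x
  have a0: "a 0 = 0"
    using Suc.prems[of 0] powser_sums_zero[of a] sums_unique2 by fastforce
  have tail: "(\<lambda>m. a (Suc m) * x ^ m) sums 0" if "0 < x" "x < 1" for x
  proof -
    have "(\<lambda>m. a (Suc m) * x ^ Suc m) sums 0"
      using Suc.prems[of x] that a0 by (subst sums_Suc_iff) simp
    from sums_mult[OF this, of "1 / x"] show ?thesis
      using that by (simp add: field_simps)
  qed
  have "summable (\<lambda>m. a (Suc m) * x ^ m)" if "norm x < 1 / 2" for x
    using powser_inside[of "\<lambda>m. a (Suc m)" "1 / 2" x] tail[of "1 / 2"] that
    by (auto simp: summable_def)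
  then have "(f \<longlongrightarrow> a (Suc 0)) (at 0)"
    by (intro powser_limit_0_strong[where s = "1 / 2"]) (auto simp: f_def)
  then have "(f \<longlongrightarrow> a (Suc 0)) (at_right 0)"
    by (rule tendsto_within_subset) simp
  moreover have "\<forall>\<^sub>F x in at_right 0. f x = 0"
    using eventually_at_right_real[OF zero_less_one]
    by eventually_elim (use tail in \<open>auto simp: f_def sums_iff\<close>)
  ultimately have a1: "a (Suc 0) = 0"
    by (metis tendsto_eventually tendsto_unique trivial_limit_at_right_real)
  have "(\<lambda>m. a (Suc m) * x ^ m) sums 0" if "0 \<le> x" "x < 1" for x
    using tail[of x] that a1 powser_sums_zero[of "\<lambda>m. a (Suc m)"] by (cases "x = 0") auto
  then show ?case by (rule Suc.IH)
qed

text \<open>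
  With \<open>F = exp H\<close>, the coefficients of \<open>x F' = (x H') F\<close> are compared. The factor \<open>x\<close> keeps the exponents
  \<open>e i\<close> and makes the identity trivial at \<open>x = 0\<close>, where \<open>F = exp H\<close> is known on one side only.
\<close>

lemma exp_polynomial_recursion:
  fixes a :: "nat \<Rightarrow> real" and d :: "'i \<Rightarrow> real" and e :: "'i \<Rightarrow> nat"
  assumes "finite I"
    and series: "\<And>x. 0 \<le> x \<Longrightarrow> x < 1 \<Longrightarrow>
      (\<lambda>m. a m * x ^ m) sums exp (c + (\<Sum>i\<in>I. d i * x ^ e i))"
  shows "real m * a m = (\<Sum>i\<in>I. real (e i) * d i * (if e i \<le> m then a (m - e i) else 0))"
proof -
  define H where "H x = c + (\<Sum>i\<in>I. d i * x ^ e i)" for x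
  define F where "F x = (\<Sum>m. a m * x ^ m)" for x
  define b where "b i m = (if e i \<le> m then a (m - e i) else 0)" for i m
  have F: "F x = exp (H x)" if "0 \<le> x" "x < 1" for x
    using series[OF that] by (simp add: F_def H_def sums_iff)
  have summ: "summable (\<lambda>m. a m * x ^ m)" if x: "norm x < 1" for x
  proof -
    obtain y where "norm x < y" "y < 1" using dense[OF x] by metis
    then have "summable (\<lambda>m. a m * y ^ m)"
      using sums_summable[OF series[of y]] norm_ge_zero[of x] by linarith
    then show ?thesis
      by (rule powser_inside) (use \<open>norm x < y\<close> in auto)
  qed
  have derivative: "(\<lambda>m. real m * a m * x ^ m) sums
      (x * (F x * (\<Sum>i\<in>I. d i * (real (e i) * x ^ (e i - 1)))))" if x: "0 < x" "x < 1" for x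
  proof -
    have "DERIV F x :> (\<Sum>m. diffs a m * x ^ m)"
      unfolding F_def using x by (intro termdiffs_strong'[where K = 1] summ) auto
    moreover have "DERIV F x :> exp (H x) * (\<Sum>i\<in>I. d i * (real (e i) * x ^ (e i - 1)))"
    proof -
      have "DERIV H x :> 0 + (\<Sum>i\<in>I. d i * (real (e i) * x ^ (e i - 1)))"
        unfolding H_def
        by (intro DERIV_add DERIV_const DERIV_sum DERIV_cmult DERIV_pow[unfolded One_nat_def[symmetric]])
      then have "DERIV (\<lambda>x. exp (H x)) x :> exp (H x) * (\<Sum>i\<in>I. d i * (real (e i) * x ^ (e i - 1)))"
        using DERIV_chain2[OF DERIV_exp] by fastforce
      then show ?thesis
        by (rule has_field_derivative_transform_within_open[where S = "{0<..<1}"])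
           (use x F in auto)
    qed
    ultimately have eq: "(\<Sum>m. diffs a m * x ^ m) = F x * (\<Sum>i\<in>I. d i * (real (e i) * x ^ (e i - 1)))"
      using DERIV_unique F x by auto
    have "summable (\<lambda>m. diffs a m * x ^ m)"
      using termdiff_converges[of x 1 a] x summ by auto
    then have "(\<lambda>m. diffs a m * x ^ m) sums (F x * (\<Sum>i\<in>I. d i * (real (e i) * x ^ (e i - 1))))"
      using eq summable_sums by fastforce
    from sums_mult[OF this, of x]
    have "(\<lambda>m. real (Suc m) * a (Suc m) * x ^ Suc m) sums
        (x * (F x * (\<Sum>i\<in>I. d i * (real (e i) * x ^ (e i - 1)))))"
      by (simp add: diffs_def algebra_simps)
    then show ?thesis by (subst (asm) sums_Suc_iff) simp
  qed
  have shift: "(\<lambda>m. b i m * x ^ m) sums (x ^ e i * F x)" if "0 \<le> x" "x < 1" for i x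
  proof -
    have "(\<lambda>m. a m * x ^ m) sums F x" using summ[of x] that by (auto simp: F_def)
    from sums_mult[OF this, of "x ^ e i"]
    have "(\<lambda>m. b i (m + e i) * x ^ (m + e i)) sums (x ^ e i * F x)"
      by (simp add: b_def power_add algebra_simps)
    moreover have "(\<Sum>m<e i. b i m * x ^ m) = 0" by (simp add: b_def)
    ultimately show ?thesis by (subst (asm) sums_iff_shift) simp
  qed
  have rhs: "(\<lambda>m. (\<Sum>i\<in>I. real (e i) * d i * b i m) * x ^ m) sums
      (\<Sum>i\<in>I. real (e i) * d i * (x ^ e i * F x))" if "0 \<le> x" "x < 1" for x
    unfolding sum_distrib_right mult.assoc
    by (intro sums_sum sums_mult shift that)
  have "(\<lambda>m. (real m * a m - (\<Sum>i\<in>I. real (e i) * d i * b i m)) * x ^ m) sums 0"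
    if x: "0 \<le> x" "x < 1" for x
  proof (cases "x = 0")
    case True
    have "(\<Sum>i\<in>I. real (e i) * d i * b i 0) = 0"
      by (intro sum.neutral) (auto simp: b_def)
    then show ?thesis
      using True powser_sums_zero[of "\<lambda>m. real m * a m - (\<Sum>i\<in>I. real (e i) * d i * b i m)"] by simp
  next
    case False
    have "x * (F x * (\<Sum>i\<in>I. d i * (real (e i) * x ^ (e i - 1))))
        = (\<Sum>i\<in>I. real (e i) * d i * (x ^ e i * F x))"
      unfolding sum_distrib_left
    proof (rule sum.cong)
      fix i
      show "x * (F x * (d i * (real (e i) * x ^ (e i - 1)))) = real (e i) * d i * (x ^ e i * F x)"
        by (cases "e i") auto
    qed simp
    then show ?thesis
      using sums_diff[OF derivative[of x] rhs[of x]] False x by (simp add: left_diff_distrib)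
  qed
  from power_series_zero_on_unit_interval[OF this, of m]
  show ?thesis by (simp add: b_def)
qed

text \<open>
  The weight \<open>Z\<close> carries the variables of a joint generating function that are held fixed while the
  one belonging to \<open>Y\<close> is expanded.
\<close>

lemma (in prob_space) weighted_pgf_sums:
  fixes Z :: "'a \<Rightarrow> real"
  assumes [measurable]: "Y \<in> measurable M (count_space UNIV)" and Z: "integrable M Z"
    and x: "0 \<le> x" "x \<le> 1"
  shows "(\<lambda>m. expectation (\<lambda>\<omega>. Z \<omega> * of_bool (Y \<omega> = m)) * x ^ m) sums
    expectation (\<lambda>\<omega>. Z \<omega> * x ^ Y \<omega>)"
proof -
  note [measurable] = borel_measurable_integrable[OF Z]
  have int: "integrable M (\<lambda>\<omega>. Z \<omega> * of_bool (Y \<omega> = m))" for m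
    by (rule Bochner_Integration.integrable_bound[OF Z]) auto
  have "(\<Sum>m<r. expectation (\<lambda>\<omega>. Z \<omega> * of_bool (Y \<omega> = m)) * x ^ m)
      = expectation (\<lambda>\<omega>. Z \<omega> * (if Y \<omega> < r then x ^ Y \<omega> else 0))" for r
  proof -
    have "(\<Sum>m<r. expectation (\<lambda>\<omega>. Z \<omega> * of_bool (Y \<omega> = m)) * x ^ m)
        = expectation (\<lambda>\<omega>. \<Sum>m<r. Z \<omega> * of_bool (Y \<omega> = m) * x ^ m)"
      using int by simp
    also have "\<dots> = expectation (\<lambda>\<omega>. Z \<omega> * (if Y \<omega> < r then x ^ Y \<omega> else 0))"
    proof (intro Bochner_Integration.integral_cong refl)
      fix \<omega>
      have "(\<Sum>m<r. Z \<omega> * of_bool (Y \<omega> = m) * x ^ m)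
          = (\<Sum>m<r. if Y \<omega> = m then Z \<omega> * x ^ m else 0)"
        by (intro sum.cong) auto
      then show "(\<Sum>m<r. Z \<omega> * of_bool (Y \<omega> = m) * x ^ m)
          = Z \<omega> * (if Y \<omega> < r then x ^ Y \<omega> else 0)" by simp
    qed
    finally show ?thesis .
  qed
  moreover have "(\<lambda>r. expectation (\<lambda>\<omega>. Z \<omega> * (if Y \<omega> < r then x ^ Y \<omega> else 0)))
      \<longlonglongrightarrow> expectation (\<lambda>\<omega>. Z \<omega> * x ^ Y \<omega>)"
  proof (rule integral_dominated_convergence[where w = "\<lambda>\<omega>. \<bar>Z \<omega>\<bar>"])
    have "(\<lambda>r. if Y \<omega> < r then x ^ Y \<omega> else 0) \<longlonglongrightarrow> x ^ Y \<omega>" for \<omega>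
      by (rule tendsto_eventually, rule eventually_mono[OF eventually_gt_at_top[of "Y \<omega>"]]) simp
    then show "AE \<omega> in M. (\<lambda>r. Z \<omega> * (if Y \<omega> < r then x ^ Y \<omega> else 0)) \<longlonglongrightarrow> Z \<omega> * x ^ Y \<omega>"
      by (intro AE_I2 tendsto_mult_left)
    show "AE \<omega> in M. norm (Z \<omega> * (if Y \<omega> < r then x ^ Y \<omega> else 0)) \<le> \<bar>Z \<omega>\<bar>" for r
      using x by (auto simp: abs_mult power_le_one intro!: mult_left_le)
  qed (use Z in auto)
  ultimately show ?thesis by (simp add: sums_def)
qed

text \<open>
  A linear relation between joint generating functions passes to the point probabilities: expanding in
  one variable and comparing coefficients replaces its power by the indicator of \<open>Y i k = n k\<close>, which
  is absorbed into the weight before the next variable is treated. The relation involves several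
  random vectors because the recursion relates the vector of queue lengths to shifts of itself.
\<close>

lemma (in prob_space) pgf_coefficient_identity:
  fixes Z :: "'i \<Rightarrow> 'a \<Rightarrow> real" and Y :: "'i \<Rightarrow> 'k \<Rightarrow> 'a \<Rightarrow> nat" and c :: "'i \<Rightarrow> real"
  assumes "finite K" and "finite I"
    and "\<And>i k. i \<in> I \<Longrightarrow> k \<in> K \<Longrightarrow> Y i k \<in> measurable M (count_space UNIV)"
    and "\<And>i. i \<in> I \<Longrightarrow> integrable M (Z i)"
    and "\<And>z. (\<And>k. 0 \<le> z k \<and> z k \<le> 1) \<Longrightarrow>
      (\<Sum>i\<in>I. c i * expectation (\<lambda>\<omega>. Z i \<omega> * (\<Prod>k\<in>K. z k ^ Y i k \<omega>))) = 0"
  shows "(\<Sum>i\<in>I. c i * expectation (\<lambda>\<omega>. Z i \<omega> * of_bool (\<forall>k\<in>K. Y i k \<omega> = n k))) = 0"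
  using assms(1,3-)
proof (induction K arbitrary: Z rule: finite_induct)
  case empty
  from empty(3)[of "\<lambda>_. 0"] show ?case by simp
next
  case (insert k K)
  have [measurable]: "Y i k' \<in> measurable M (count_space UNIV)" if "i \<in> I" "k' \<in> insert k K" for i k'
    using insert.prems(1) that by simp
  have [measurable]: "Z i \<in> borel_measurable M" if "i \<in> I" for i
    using insert.prems(2) that by blast
  have "(\<Sum>i\<in>I. c i * expectation (\<lambda>\<omega>. (Z i \<omega> * of_bool (Y i k \<omega> = n k)) *
      of_bool (\<forall>k\<in>K. Y i k \<omega> = n k))) = 0"
  proof (rule insert.IH)
    fix i assume i: "i \<in> I"
    show "integrable M (\<lambda>\<omega>. Z i \<omega> * of_bool (Y i k \<omega> = n k))"
      by (rule Bochner_Integration.integrable_bound[OF insert.prems(2)[OF i]]) (use i in auto)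
  next
    fix z :: "'k \<Rightarrow> real" assume z: "\<And>k. 0 \<le> z k \<and> z k \<le> 1"
    define W where "W i \<omega> = Z i \<omega> * (\<Prod>k\<in>K. z k ^ Y i k \<omega>)" for i \<omega>
    have W: "integrable M (W i)" if "i \<in> I" for i
    proof (rule Bochner_Integration.integrable_bound[OF insert.prems(2)[OF that]])
      show "W i \<in> borel_measurable M" unfolding W_def using that by measurable
      have "(\<Prod>k\<in>K. z k ^ Y i k \<omega>) \<le> 1" "0 \<le> (\<Prod>k\<in>K. z k ^ Y i k \<omega>)" for \<omega>
        using z by (auto intro!: prod_le_1 prod_nonneg simp: power_le_one)
      then show "AE \<omega> in M. norm (W i \<omega>) \<le> norm (Z i \<omega>)"
        by (auto simp: W_def abs_mult intro!: mult_left_le)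
    qed
    have "(\<lambda>m. (\<Sum>i\<in>I. c i * expectation (\<lambda>\<omega>. W i \<omega> * of_bool (Y i k \<omega> = m))) * x ^ m) sums 0"
      if x: "0 \<le> x" "x < 1" for x
    proof -
      have "(\<lambda>m. \<Sum>i\<in>I. c i * (expectation (\<lambda>\<omega>. W i \<omega> * of_bool (Y i k \<omega> = m)) * x ^ m)) sums
          (\<Sum>i\<in>I. c i * expectation (\<lambda>\<omega>. W i \<omega> * x ^ Y i k \<omega>))"
        by (intro sums_sum sums_mult weighted_pgf_sums W) (use x in auto)
      moreover have "(\<Sum>i\<in>I. c i * expectation (\<lambda>\<omega>. W i \<omega> * x ^ Y i k \<omega>)) = 0"
      proof -
        have "(\<Prod>k'\<in>insert k K. (z(k := x)) k' ^ Y i k' \<omega>)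
            = (\<Prod>k\<in>K. z k ^ Y i k \<omega>) * x ^ Y i k \<omega>" for i \<omega>
        proof -
          have "(\<Prod>k'\<in>K. (z(k := x)) k' ^ Y i k' \<omega>) = (\<Prod>k\<in>K. z k ^ Y i k \<omega>)"
            by (rule prod.cong) (use insert.hyps in auto)
          then show ?thesis using insert.hyps by (simp add: mult.commute)
        qed
        then show ?thesis
          using insert.prems(3)[of "z(k := x)"] z x by (simp add: W_def mult.assoc)
      qed
      ultimately show ?thesis by (simp add: sum_distrib_right mult.assoc)
    qed
    from power_series_zero_on_unit_interval[OF this, of "n k"]
    show "(\<Sum>i\<in>I. c i * expectation (\<lambda>\<omega>. Z i \<omega> * of_bool (Y i k \<omega> = n k) *
        (\<Prod>k\<in>K. z k ^ Y i k \<omega>))) = 0"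
      by (simp add: W_def mult_ac)
  qed (use insert.prems in auto)
  then show ?case by (simp add: mult.assoc of_bool_conj)
qed

lemma sum_PiE_insert:
  assumes "k \<notin> K"
  shows "(\<Sum>i\<in>PiE (insert k K) A. f i) = (\<Sum>i\<in>PiE K A. \<Sum>r\<in>A k. f (i(k := r)))"
proof -
  have "(\<Sum>i\<in>PiE (insert k K) A. f i) = (\<Sum>(r, i)\<in>A k \<times> PiE K A. f (i(k := r)))"
    unfolding PiE_insert_eq using inj_combinator[OF assms, of A]
    by (subst sum.reindex) (auto simp: case_prod_beta)
  also have "\<dots> = (\<Sum>r\<in>A k. \<Sum>i\<in>PiE K A. f (i(k := r)))"
    by (rule sum.cartesian_product[symmetric])
  also have "\<dots> = (\<Sum>i\<in>PiE K A. \<Sum>r\<in>A k. f (i(k := r)))" by (rule sum.swap)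
  finally show ?thesis .
qed

lemma binomial_power_expansion:
  fixes b y :: real
  assumes "R \<le> N"
  shows "(b + y) ^ R = (\<Sum>r\<in>{0..N}. of_bool (r \<le> R) * (fact R / fact (R - r)) * b ^ (R - r) * (y ^ r / fact r))"
proof -
  have "(b + y) ^ R = (\<Sum>r\<le>R. of_nat (R choose r) * y ^ r * b ^ (R - r))"
    by (subst add.commute) (rule binomial_ring)
  also have "\<dots> = (\<Sum>r\<le>R. of_bool (r \<le> R) * (fact R / fact (R - r)) * b ^ (R - r) * (y ^ r / fact r))"
    by (intro sum.cong) (auto simp: binomial_fact field_simps)
  also have "\<dots> = (\<Sum>r\<in>{0..N}. of_bool (r \<le> R) * (fact R / fact (R - r)) * b ^ (R - r) * (y ^ r / fact r))"
    using assms by (intro sum.mono_neutral_left) auto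
  finally show ?thesis .
qed

text \<open>
  The constant \<open>b\<close> stands for the customers that are in none of the queues in \<open>K\<close>. Splitting off
  one summand \<open>y k\<close> and adding it to \<open>b\<close> reduces the claim to the binomial theorem. All exponents range
  over the same box, with an indicator for \<open>\<Sum> i \<le> N\<close>, so that the index set is a product.
\<close>

lemma multinomial_power_expansion:
  fixes b :: real
  assumes "finite K"
  shows "(b + (\<Sum>k\<in>K. y k)) ^ N = (\<Sum>i\<in>PiE K (\<lambda>_. {0..N}). of_bool (sum i K \<le> N) *
    ((fact N / fact (N - sum i K)) * b ^ (N - sum i K) * (\<Prod>k\<in>K. y k ^ i k / fact (i k))))"
  using assms
proof (induction K arbitrary: b rule: finite_induct)
  case empty
  then show ?case by simp
next
  case (insert k K)
  have upd: "sum (i(k := r)) (insert k K) = r + sum i K"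
    "(\<Prod>k'\<in>insert k K. y k' ^ (i(k := r)) k' / fact ((i(k := r)) k'))
      = y k ^ r / fact r * (\<Prod>k\<in>K. y k ^ i k / fact (i k))" for i r
  proof -
    have "sum (i(k := r)) K = sum i K" by (rule sum.cong) (use insert.hyps in auto)
    then show "sum (i(k := r)) (insert k K) = r + sum i K" using insert.hyps by simp
    have "(\<Prod>k'\<in>K. y k' ^ (i(k := r)) k' / fact ((i(k := r)) k')) = (\<Prod>k\<in>K. y k ^ i k / fact (i k))"
      by (rule prod.cong) (use insert.hyps in auto)
    then show "(\<Prod>k'\<in>insert k K. y k' ^ (i(k := r)) k' / fact ((i(k := r)) k'))
      = y k ^ r / fact r * (\<Prod>k\<in>K. y k ^ i k / fact (i k))" using insert.hyps by simp
  qed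
  have "(b + (\<Sum>k\<in>insert k K. y k)) ^ N = (b + y k + (\<Sum>k\<in>K. y k)) ^ N"
    using insert.hyps by (simp add: add.assoc)
  also have "\<dots> = (\<Sum>i\<in>PiE K (\<lambda>_. {0..N}). of_bool (sum i K \<le> N) *
    ((fact N / fact (N - sum i K)) * (b + y k) ^ (N - sum i K) * (\<Prod>k\<in>K. y k ^ i k / fact (i k))))"
    by (rule insert.IH)
  also have "\<dots> = (\<Sum>i\<in>PiE K (\<lambda>_. {0..N}). \<Sum>r\<in>{0..N}. of_bool (sum (i(k := r)) (insert k K) \<le> N) *
    ((fact N / fact (N - sum (i(k := r)) (insert k K))) * b ^ (N - sum (i(k := r)) (insert k K)) *
      (\<Prod>k'\<in>insert k K. y k' ^ (i(k := r)) k' / fact ((i(k := r)) k'))))"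
    unfolding upd
  proof (rule sum.cong[OF refl])
    fix i
    define s P where "s = sum i K" and "P = (\<Prod>k\<in>K. y k ^ i k / fact (i k))"
    have "of_bool (s \<le> N) * ((fact N / fact (N - s)) * (b + y k) ^ (N - s) * P)
        = (\<Sum>r\<in>{0..N}. of_bool (s \<le> N) * ((fact N / fact (N - s)) *
            (of_bool (r \<le> N - s) * (fact (N - s) / fact (N - s - r)) * b ^ (N - s - r) * (y k ^ r / fact r)) * P))"
      by (subst binomial_power_expansion[of "N - s" N]) (simp_all add: sum_distrib_left sum_distrib_right)
    also have "\<dots> = (\<Sum>r\<in>{0..N}. of_bool (r + s \<le> N) *
        ((fact N / fact (N - (r + s))) * b ^ (N - (r + s)) * (y k ^ r / fact r * P)))"
    proof (rule sum.cong[OF refl])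
      fix r
      show "of_bool (s \<le> N) * ((fact N / fact (N - s)) *
            (of_bool (r \<le> N - s) * (fact (N - s) / fact (N - s - r)) * b ^ (N - s - r) * (y k ^ r / fact r)) * P)
        = of_bool (r + s \<le> N) *
        ((fact N / fact (N - (r + s))) * b ^ (N - (r + s)) * (y k ^ r / fact r * P))"
      proof (cases "r + s \<le> N")
        case True
        then have "N - s - r = N - (r + s)" "r \<le> N - s" "s \<le> N" by auto
        then show ?thesis using True by simp
      qed auto
    qed
    finally show "of_bool (sum i K \<le> N) * ((fact N / fact (N - sum i K)) * (b + y k) ^ (N - sum i K) *
        (\<Prod>k\<in>K. y k ^ i k / fact (i k)))
      = (\<Sum>r\<in>{0..N}. of_bool (r + sum i K \<le> N) * ((fact N / fact (N - (r + sum i K))) *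
        b ^ (N - (r + sum i K)) * (y k ^ r / fact r * (\<Prod>k\<in>K. y k ^ i k / fact (i k)))))"
      by (simp only: s_def P_def)
  qed
  also have "\<dots> = (\<Sum>i\<in>PiE (insert k K) (\<lambda>_. {0..N}). of_bool (sum i (insert k K) \<le> N) *
    ((fact N / fact (N - sum i (insert k K))) * b ^ (N - sum i (insert k K)) *
      (\<Prod>k\<in>insert k K. y k ^ i k / fact (i k))))"
    by (rule sum_PiE_insert[OF insert.hyps(2), symmetric])
  finally show ?case .
qed

section \<open>Borel functions as iterated limits of continuous functions\<close>

text \<open>
  The least class of functions to which a property spreads when it holds for continuous functions with
  values in \<open>[0, 1]\<close> and is stable under pointwise limits of sequences. This serves for statements that
  are not linear in the function, where an induction over simple functions does not apply.
\<close>

inductive baire :: "(real \<Rightarrow> real) \<Rightarrow> bool" where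
  continuous: "continuous_on UNIV f \<Longrightarrow> (\<And>x. 0 \<le> f x \<and> f x \<le> 1) \<Longrightarrow> baire f"
| limit: "(\<And>m. baire (f m)) \<Longrightarrow> (\<And>x. (\<lambda>m. f m x) \<longlonglongrightarrow> g x) \<Longrightarrow> baire g"

text \<open>
  With one argument fixed, the functions admissible as the other argument are closed under limits. So
  the claim follows by induction over \<open>g\<close> for continuous \<open>f\<close>, and then by induction over \<open>f\<close>.
\<close>

lemma baire_compose2:
  assumes "baire f" "baire g"
    and \<phi>: "continuous_on UNIV (case_prod \<phi>)" "\<And>x y. 0 \<le> \<phi> x y \<and> \<phi> x y \<le> (1::real)"
  shows "baire (\<lambda>x. \<phi> (f x) (g x))"
proof -
  have lim: "(\<lambda>m. \<phi> (a m) (b m)) \<longlonglongrightarrow> \<phi> x y" if "a \<longlonglongrightarrow> x" "b \<longlonglongrightarrow> y" for a b x y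
    using continuous_on_tendsto_compose[OF \<phi>(1) tendsto_Pair[OF that]] by simp
  have cont: "baire (\<lambda>x. \<phi> (f x) (g x))"
    if "continuous_on UNIV f" "baire g" for f g
    using that(2)
  proof induction
    case (continuous g)
    have "continuous_on UNIV (\<lambda>x. case_prod \<phi> (f x, g x))"
      by (rule continuous_on_compose2[OF \<phi>(1)])
         (use continuous that(1) in \<open>auto intro!: continuous_on_Pair\<close>)
    then show ?case using \<phi>(2) by (intro baire.continuous) auto
  next
    case (limit g' g)
    show ?case by (rule baire.limit[OF limit.IH]) (rule lim[OF tendsto_const limit.hyps(2)])
  qed
  show ?thesis
    using assms(1)
  proof induction
    case (continuous f)
    then show ?case using assms(2) by (intro cont)
  next
    case (limit f' f)
    show ?case by (rule baire.limit[OF limit.IH]) (rule lim[OF limit.hyps(2) tendsto_const])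
  qed
qed

text \<open>
  The sets with a Baire indicator form a sigma-algebra that contains the closed sets, whose
  indicators are limits of the functions \<open>max 0 (1 - m dist(x, A))\<close>.
\<close>

lemma baire_indicator:
  assumes "A \<in> sets borel"
  shows "baire (indicator A)"
proof -
  have compl: "baire (indicator (- A))" if "baire (indicator A)" for A
  proof -
    \<comment> \<open>The truncation to \<open>[0, 1]\<close> makes the operation admissible on the whole plane.\<close>
    have "baire (\<lambda>x. (\<lambda>a b. max 0 (min 1 (1 - a))) (indicator A x) (indicator A x))"
      by (rule baire_compose2[OF that that]) (auto intro!: continuous_intros simp: split_beta)
    also have "(\<lambda>x. (\<lambda>a b. max 0 (min 1 (1 - a))) (indicator A x) (indicator A x)) = (indicator (- A) :: real \<Rightarrow> real)"
      by (auto simp: indicator_def fun_eq_iff)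
    finally show ?thesis .
  qed
  have union: "baire (indicator (A \<union> B))" if "baire (indicator A)" "baire (indicator B)" for A B
  proof -
    have "baire (\<lambda>x. (\<lambda>a b. max 0 (min 1 (a + b))) (indicator A x) (indicator B x))"
      by (rule baire_compose2[OF that]) (auto intro!: continuous_intros simp: split_beta)
    also have "(\<lambda>x. (\<lambda>a b. max 0 (min 1 (a + b))) (indicator A x) (indicator B x)) = (indicator (A \<union> B) :: real \<Rightarrow> real)"
      by (auto simp: indicator_def fun_eq_iff)
    finally show ?thesis .
  qed
  have "indicator {} = (\<lambda>_::real. 0::real)" by (simp add: fun_eq_iff)
  moreover have "baire (\<lambda>_. 0)" by (rule baire.continuous) auto
  ultimately have zero: "baire (indicator {})" "baire (\<lambda>_. 0)" by metis+
  have union_seq: "baire (indicator (\<Union>m::nat. A m))" if "\<And>m. baire (indicator (A m))" for A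
  proof (rule baire.limit)
    show "baire (indicator (\<Union>m<r. A m))" for r
    proof (induction r)
      case 0
      show ?case using zero unfolding lessThan_0 by (simp only: UN_empty)
    qed (simp add: union that lessThan_Suc)
    show "(\<lambda>r. indicator (\<Union>m<r. A m) x) \<longlonglongrightarrow> indicator (\<Union>m. A m) x" for x
      by (rule LIMSEQ_indicator_UN)
  qed
  have closed: "baire (indicator A)" if "closed A" for A :: "real set"
  proof (cases "A = {}")
    case False
    show ?thesis
    proof (rule baire.limit)
      show "baire (\<lambda>x. max 0 (1 - real m * infdist x A))" for m
        by (rule baire.continuous) (auto intro!: continuous_intros simp: infdist_nonneg)
      show "(\<lambda>m. max 0 (1 - real m * infdist x A)) \<longlonglongrightarrow> indicator A x" for x
      proof (cases "x \<in> A")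
        case True
        then show ?thesis by simp
      next
        case False
        then have pos: "infdist x A > 0"
          using \<open>A \<noteq> {}\<close> \<open>closed A\<close> in_closed_iff_infdist_zero infdist_nonneg
          by (metis less_eq_real_def)
        obtain r :: nat where r: "1 / infdist x A < real r" using reals_Archimedean2 by blast
        have "\<forall>\<^sub>F m in sequentially. max 0 (1 - real m * infdist x A) = 0"
          using eventually_ge_at_top[of r]
        proof eventually_elim
          case (elim m)
          then have "1 / infdist x A < real m" using r by linarith
          then show ?case using pos by (simp add: field_simps)
        qed
        then show ?thesis using False by (simp add: tendsto_eventually)
      qed
    qed
  qed (use zero in simp)
  have "A \<in> sigma_sets UNIV {S. open S}" using assms by (simp add: borel_def)
  then show ?thesis
  proof induction
    case (Basic S)
    then show ?case using compl[OF closed[OF closed_Compl[of S]]] by simp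
  next
    case (Compl S)
    then show ?case using compl by (simp add: Compl_eq_Diff_UNIV)
  qed (use zero union_seq in auto)
qed

lemma baire_borel:
  assumes "g \<in> borel_measurable borel" and "\<And>x. 0 \<le> g x" and "\<And>x. g x \<le> 1"
  shows "baire g"
proof -
  \<comment> \<open>The factor \<open>c\<close> is needed for the scaling step: \<open>min 1 u\<close> does not determine \<open>min 1 (c * u)\<close>.\<close>
  have "\<forall>c\<ge>0. baire (\<lambda>x. min 1 (c * g x))"
    using assms(1,2)
  proof (induction rule: borel_measurable_induct_real)
    case (set A)
    show ?case
    proof (intro allI impI)
      fix c :: real assume "0 \<le> c"
      have "baire (\<lambda>x. (\<lambda>a b. max 0 (min 1 (c * a))) (indicator A x) (indicator A x))"
        by (rule baire_compose2[OF baire_indicator baire_indicator])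
           (auto intro!: continuous_intros simp: split_beta set)
      also have "(\<lambda>x. (\<lambda>a b. max 0 (min 1 (c * a))) (indicator A x) (indicator A x))
          = (\<lambda>x. min 1 (c * indicator A x))"
        using \<open>0 \<le> c\<close> by (auto simp: indicator_def)
      finally show "baire (\<lambda>x. min 1 (c * indicator A x))" .
    qed
  next
    case (mult u c)
    then show ?case by (simp add: mult.assoc[symmetric])
  next
    case (add u v)
    show ?case
    proof (intro allI impI)
      fix c :: real assume c: "0 \<le> c"
      have "baire (\<lambda>x. (\<lambda>a b. max 0 (min 1 (a + b))) (min 1 (c * u x)) (min 1 (c * v x)))"
      proof (rule baire_compose2[where \<phi> = "\<lambda>a b. max 0 (min 1 (a + b))"])
        show "baire (\<lambda>x. min 1 (c * u x))" "baire (\<lambda>x. min 1 (c * v x))"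
          using c add by blast+
      qed (auto intro!: continuous_intros simp: split_beta)
      also have "(\<lambda>x. (\<lambda>a b. max 0 (min 1 (a + b))) (min 1 (c * u x)) (min 1 (c * v x)))
          = (\<lambda>x. min 1 (c * (v x + u x)))"
      proof
        fix x
        have "0 \<le> c * u x" "0 \<le> c * v x" using c add by auto
        then show "max 0 (min 1 (min 1 (c * u x) + min 1 (c * v x))) = min 1 (c * (v x + u x))"
          by (auto simp: distrib_left min_def max_def)
      qed
      finally show "baire (\<lambda>x. min 1 (c * (v x + u x)))" .
    qed
  next
    case (seq U)
    show ?case
    proof (intro allI impI)
      fix c :: real assume "0 \<le> c"
      show "baire (\<lambda>x. min 1 (c * g x))"
      proof (rule baire.limit)
        show "baire (\<lambda>x. min 1 (c * U i x))" for i using seq \<open>0 \<le> c\<close> by blast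
        show "(\<lambda>i. min 1 (c * U i x)) \<longlonglongrightarrow> min 1 (c * g x)" for x
          using seq by (intro tendsto_min tendsto_const tendsto_mult_left) auto
      qed
    qed
  qed
  then have "baire (\<lambda>x. min 1 (1 * g x))" by (meson zero_le_one)
  also have "(\<lambda>x. min 1 (1 * g x)) = g" using assms(3) by (intro ext) (simp add: min_absorb2)
  finally show ?thesis .
qed

lemma baire_properties:
  assumes "baire g"
  shows "g \<in> borel_measurable borel" "0 \<le> g x" "g x \<le> 1"
proof -
  have "g \<in> borel_measurable borel \<and> (\<forall>x. 0 \<le> g x \<and> g x \<le> 1)"
    using assms
  proof induction
    case (continuous f)
    then show ?case by (auto intro: borel_measurable_continuous_onI)
  next
    case (limit f g)
    then have [measurable]: "f m \<in> borel_measurable borel" for m by blast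
    have "g \<in> borel_measurable borel"
      by (rule borel_measurable_LIMSEQ_real[where u = f]) (use limit in auto)
    moreover have "0 \<le> g x" "g x \<le> 1" for x
      using limit(3) by (auto intro!: LIMSEQ_le_const[OF limit(2)] LIMSEQ_le_const2[OF limit(2)])
    ultimately show ?case by blast
  qed
  then show "g \<in> borel_measurable borel" "0 \<le> g x" "g x \<le> 1" by auto
qed

section \<open>Products over the points of a Poisson process\<close>

lemma finite_down_closed_eq_lessThan_card:
  fixes A :: "nat set"
  assumes "finite A" and down: "\<And>i j. j \<in> A \<Longrightarrow> i \<le> j \<Longrightarrow> i \<in> A"
  shows "A = {..<card A}"
proof (cases "A = {}")
  case False
  then have "A = {..Max A}"
    using assms by (auto intro: down[OF Max_in])
  then show ?thesis by (metis card_atMost lessThan_Suc_atMost)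
qed simp

locale poisson_process = prob_space M
  for M :: "'w measure" +
  fixes lam :: "real \<Rightarrow> real" and T :: "nat \<Rightarrow> 'w \<Rightarrow> ereal"
  assumes rate_integrable_upto: "\<And>t. 0 \<le> t \<Longrightarrow> set_integrable lborel {0..t} lam"
    and poisson: "poisson_arrival_times M lam T"
begin

text \<open>
  On the null event of infinitely many arrivals up to \<open>t\<close> the index set is infinite and the product is
  \<open>1\<close>; this is a measurable event, so the product is measurable everywhere.
\<close>

definition arrival_product :: "(real \<Rightarrow> real) \<Rightarrow> real \<Rightarrow> 'w \<Rightarrow> real" where
  "arrival_product g t \<omega> = (\<Prod>i | T i \<omega> \<le> ereal t. g (real_of_ereal (T i \<omega>)))"

lemma arrival_time_measurable [measurable]: "T i \<in> borel_measurable M"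
  using poisson by (simp add: poisson_arrival_times_def)

lemma arrival_times_mono: "\<omega> \<in> space M \<Longrightarrow> i \<le> j \<Longrightarrow> T i \<omega> \<le> T j \<omega>"
  using poisson by (auto simp: poisson_arrival_times_def incseq_def)

lemma AE_finitely_many_positive_arrivals:
  "AE \<omega> in M. (\<forall>i. 0 < T i \<omega>) \<and> (\<forall>t. finite {i. T i \<omega> \<le> ereal t})"
  using poisson by (simp add: poisson_arrival_times_def)

lemma arrivals_measurable [measurable]: "arrivals T s t \<in> measurable M (count_space UNIV)"
  unfolding arrivals_def[abs_def] by measurable

lemma arrival_product_eq:
  assumes "\<omega> \<in> space M"
  shows "arrival_product g t \<omega> =
    (\<Prod>i<card {i. T i \<omega> \<le> ereal t}. g (real_of_ereal (T i \<omega>)))"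
proof (cases "finite {i. T i \<omega> \<le> ereal t}")
  case True
  then have "{i. T i \<omega> \<le> ereal t} = {..<card {i. T i \<omega> \<le> ereal t}}"
    by (rule finite_down_closed_eq_lessThan_card)
       (use arrival_times_mono[OF assms] order_trans in blast)
  then show ?thesis unfolding arrival_product_def by metis
qed (simp add: arrival_product_def)

lemma arrival_product_measurable [measurable]:
  assumes [measurable]: "g \<in> borel_measurable borel"
  shows "arrival_product g t \<in> borel_measurable M"
proof -
  have "(\<lambda>\<omega>. \<Prod>i<card {i. T i \<omega> \<le> ereal t}. g (real_of_ereal (T i \<omega>))) \<in> borel_measurable M"
    by (rule measurable_compose_countable[where g = "\<lambda>\<omega>. card {i. T i \<omega> \<le> ereal t}"]) measurable
  then show ?thesis by (subst measurable_cong[OF arrival_product_eq])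
qed

lemma arrival_product_bounds:
  assumes "\<And>x. 0 \<le> g x \<and> g x \<le> 1"
  shows "0 \<le> arrival_product g t \<omega>" "arrival_product g t \<omega> \<le> 1"
  using assms by (auto simp: arrival_product_def intro!: prod_nonneg prod_le_1)

lemma rate_set_integrable:
  assumes "A \<in> sets borel" "A \<subseteq> {0..t}"
  shows "set_integrable lborel A lam"
proof (cases "0 \<le> t")
  case True
  show ?thesis
    by (rule set_integrable_subset[OF rate_integrable_upto[OF True]]) (use assms in auto)
next
  case False
  then have "A = {}" using assms by auto
  then show ?thesis by simp
qed

lemma rate_times_bounded_integrable:
  assumes A: "A \<in> sets borel" "A \<subseteq> {0..t}" and [measurable]: "h \<in> borel_measurable borel"
    and bound: "\<And>x. \<bar>h x\<bar> \<le> C"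
  shows "set_integrable lborel A (\<lambda>\<tau>. lam \<tau> * h \<tau>)"
proof -
  have int: "integrable lborel (\<lambda>\<tau>. indicator A \<tau> * lam \<tau>)"
    using rate_set_integrable[OF A] by (simp add: set_integrable_def)
  have "integrable lborel (\<lambda>\<tau>. (indicator A \<tau> * lam \<tau>) * h \<tau>)"
  proof (rule Bochner_Integration.integrable_bound)
    show "integrable lborel (\<lambda>\<tau>. C * (indicator A \<tau> * lam \<tau>))" using int by simp
    show "(\<lambda>\<tau>. (indicator A \<tau> * lam \<tau>) * h \<tau>) \<in> borel_measurable lborel"
      using borel_measurable_integrable[OF int] by measurable
    have "\<bar>w * h \<tau>\<bar> \<le> \<bar>C * w\<bar>" for w \<tau>
      using bound[of \<tau>] abs_ge_self[of C] mult_right_mono[of "\<bar>h \<tau>\<bar>" "\<bar>C\<bar>" "\<bar>w\<bar>"]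
      by (simp add: abs_mult mult.commute)
    then show "AE \<tau> in lborel. norm ((indicator A \<tau> * lam \<tau>) * h \<tau>)
        \<le> norm (C * (indicator A \<tau> * lam \<tau>))" by simp
  qed
  then show ?thesis by (simp add: set_integrable_def mult.assoc)
qed

lemma arrivals_pgf:
  assumes "0 \<le> s" "s \<le> t" "0 \<le> c" "c \<le> 1"
  shows "expectation (\<lambda>\<omega>. c ^ arrivals T s t \<omega>)
    = exp ((LINT \<tau>:{s<..t}|lborel. lam \<tau>) * (c - 1))"
proof -
  define \<Lambda> where "\<Lambda> = (LINT \<tau>:{s<..t}|lborel. lam \<tau>)"
  have law: "prob {\<omega> \<in> space M. arrivals T s t \<omega> = m} = \<Lambda> ^ m / fact m * exp (- \<Lambda>)" for m
    using poisson assms by (simp add: poisson_arrival_times_def \<Lambda>_def)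
  have "expectation (\<lambda>\<omega>. (1::real) * of_bool (arrivals T s t \<omega> = m)) = \<Lambda> ^ m / fact m * exp (- \<Lambda>)" for m
  proof -
    have "expectation (\<lambda>\<omega>. (1::real) * of_bool (arrivals T s t \<omega> = m))
        = expectation (indicator {\<omega> \<in> space M. arrivals T s t \<omega> = m})"
      by (intro Bochner_Integration.integral_cong) (auto simp: indicator_def)
    then show ?thesis by (simp add: law)
  qed
  with weighted_pgf_sums[of "arrivals T s t" "\<lambda>_. 1" c] assms
  have "(\<lambda>m. \<Lambda> ^ m / fact m * exp (- \<Lambda>) * c ^ m) sums expectation (\<lambda>\<omega>. c ^ arrivals T s t \<omega>)"
    by simp
  moreover have "(\<lambda>m. \<Lambda> ^ m / fact m * exp (- \<Lambda>) * c ^ m) sums (exp (- \<Lambda>) * exp (\<Lambda> * c))"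
    using sums_mult[OF exp_converges[of "\<Lambda> * c"], of "exp (- \<Lambda>)"]
    by (simp add: field_simps power_mult_distrib)
  ultimately show ?thesis
    using sums_unique2 by (fastforce simp: \<Lambda>_def algebra_simps simp flip: exp_add)
qed

text \<open>
  Independence of the increments makes this a product of generating functions of Poisson variables.
\<close>

lemma arrivals_increments_pgf:
  assumes s: "0 \<le> s 0" "incseq s" and c: "\<And>r. 0 \<le> c r \<and> c r \<le> (1::real)"
  shows "expectation (\<lambda>\<omega>. \<Prod>r<n. c r ^ arrivals T (s r) (s (Suc r)) \<omega>)
    = exp (\<Sum>r<n. (LINT \<tau>:{s r<..s (Suc r)}|lborel. lam \<tau>) * (c r - 1))"
proof -
  have "indep_vars (\<lambda>_. count_space UNIV) (\<lambda>r. arrivals T (s r) (s (Suc r))) UNIV"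
    using poisson s by (simp add: poisson_arrival_times_def)
  then have "indep_vars (\<lambda>_. count_space UNIV) (\<lambda>r. arrivals T (s r) (s (Suc r))) {..<n}"
    by (rule indep_vars_subset) simp
  then have ind: "indep_vars (\<lambda>_. borel) (\<lambda>r \<omega>. c r ^ arrivals T (s r) (s (Suc r)) \<omega>) {..<n}"
    by (rule indep_vars_compose2) simp
  have "expectation (\<lambda>\<omega>. \<Prod>r<n. c r ^ arrivals T (s r) (s (Suc r)) \<omega>)
      = (\<Prod>r<n. expectation (\<lambda>\<omega>. c r ^ arrivals T (s r) (s (Suc r)) \<omega>))"
  proof (rule indep_vars_lebesgue_integral[OF _ ind])
    show "integrable M (\<lambda>\<omega>. c r ^ arrivals T (s r) (s (Suc r)) \<omega>)" for r
      by (rule integrable_const_bound[where B = 1]) (use c in \<open>auto simp: power_le_one\<close>)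
  qed simp
  also have "\<dots> = (\<Prod>r<n. exp ((LINT \<tau>:{s r<..s (Suc r)}|lborel. lam \<tau>) * (c r - 1)))"
  proof (intro prod.cong refl arrivals_pgf)
    fix r show "0 \<le> s r" "s r \<le> s (Suc r)"
      using s incseqD[OF s(2)] order_trans by (blast, simp)
  qed (use c in auto)
  also have "\<dots> = exp (\<Sum>r<n. (LINT \<tau>:{s r<..s (Suc r)}|lborel. lam \<tau>) * (c r - 1))"
    by (simp add: exp_sum)
  finally show ?thesis .
qed

lemma consecutive_intervals_cover:
  fixes s :: "nat \<Rightarrow> real"
  assumes "incseq s"
  shows "{s 0<..s n} = (\<Union>r<n. {s r<..s (Suc r)})"
proof (induction n)
  case (Suc n)
  have "{s 0<..s (Suc n)} = {s 0<..s n} \<union> {s n<..s (Suc n)}"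
    using incseqD[OF assms, of 0 n] incseqD[OF assms, of n "Suc n"] by auto
  then show ?case using Suc by (auto simp: lessThan_Suc)
qed simp

lemma consecutive_intervals_disjoint:
  fixes s :: "nat \<Rightarrow> 'b::linorder"
  assumes "incseq s" "x \<in> {s r<..s (Suc r)}" "x \<in> {s r'<..s (Suc r')}"
  shows "r = r'"
proof (rule ccontr)
  assume "r \<noteq> r'"
  then have "Suc r \<le> r' \<or> Suc r' \<le> r" by auto
  then show False
    using incseqD[OF assms(1), of "Suc r" r'] incseqD[OF assms(1), of "Suc r'" r] assms(2,3) by auto
qed

text \<open>
  For a function that is constant on the intervals of a partition, the product over the points is
  \<open>\<Prod>\<^sub>r c\<^sub>r\<^bsup>A\<^sub>r\<^esup>\<close> with \<open>A\<^sub>r\<close> the number of arrivals in the \<open>r\<close>-th interval.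
\<close>

lemma poisson_product_functional_step:
  assumes s: "s 0 = 0" "incseq s" "s n = t" and [measurable]: "g \<in> borel_measurable borel"
    and g: "\<And>x. 0 \<le> g x \<and> g x \<le> 1"
    and step: "\<And>r x. r < n \<Longrightarrow> x \<in> {s r<..s (Suc r)} \<Longrightarrow> g x = g (s (Suc r))"
  shows "expectation (arrival_product g t)
    = exp (LINT \<tau>:{0<..t}|lborel. lam \<tau> * (g \<tau> - 1))"
proof -
  have "AE \<omega> in M. arrival_product g t \<omega>
      = (\<Prod>r<n. g (s (Suc r)) ^ arrivals T (s r) (s (Suc r)) \<omega>)"
    using AE_finitely_many_positive_arrivals
  proof eventually_elim
    case (elim \<omega>)
    define A where "A r = {i. ereal (s r) < T i \<omega> \<and> T i \<omega> \<le> ereal (s (Suc r))}" for r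
    have fin: "finite (A r)" for r
      by (rule finite_subset[OF _ elim[THEN conjunct2, rule_format, of "s (Suc r)"]]) (auto simp: A_def)
    have "{i. T i \<omega> \<le> ereal t} = (\<Union>r<n. A r)"
    proof (rule set_eqI)
      fix i
      show "i \<in> {i. T i \<omega> \<le> ereal t} \<longleftrightarrow> i \<in> (\<Union>r<n. A r)"
      proof (cases "T i \<omega>")
        case (real x)
        have "0 < x" using elim[THEN conjunct1, rule_format, of i] real by simp
        then have "i \<in> {i. T i \<omega> \<le> ereal t} \<longleftrightarrow> x \<in> {s 0<..s n}" using real s by simp
        also have "\<dots> \<longleftrightarrow> i \<in> (\<Union>r<n. A r)"
          unfolding consecutive_intervals_cover[OF s(2)] using real by (auto simp: A_def)
        finally show ?thesis .
      qed (use elim[THEN conjunct1, rule_format, of i] in \<open>auto simp: A_def\<close>)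
    qed
    then have "arrival_product g t \<omega> = (\<Prod>i\<in>(\<Union>r<n. A r). g (real_of_ereal (T i \<omega>)))"
      by (simp add: arrival_product_def)
    also have "\<dots> = (\<Prod>r<n. \<Prod>i\<in>A r. g (real_of_ereal (T i \<omega>)))"
    proof (rule prod.UNION_disjoint)
      have "incseq (\<lambda>r. ereal (s r))" using s(2) by (simp add: incseq_def)
      then show "\<forall>i\<in>{..<n}. \<forall>j\<in>{..<n}. i \<noteq> j \<longrightarrow> A i \<inter> A j = {}"
        using consecutive_intervals_disjoint[of "\<lambda>r. ereal (s r)"] by (auto simp: A_def)
    qed (use fin in auto)
    also have "\<dots> = (\<Prod>r<n. \<Prod>i\<in>A r. g (s (Suc r)))"
    proof (intro prod.cong refl)
      fix r i assume "r \<in> {..<n}" "i \<in> A r"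
      then show "g (real_of_ereal (T i \<omega>)) = g (s (Suc r))"
        by (cases "T i \<omega>") (auto simp: A_def intro: step)
    qed
    finally show ?case by (simp add: A_def arrivals_def)
  qed
  then have "expectation (arrival_product g t)
      = expectation (\<lambda>\<omega>. \<Prod>r<n. g (s (Suc r)) ^ arrivals T (s r) (s (Suc r)) \<omega>)"
    by (intro integral_cong_AE) measurable
  also have "\<dots> = exp (\<Sum>r<n. (LINT \<tau>:{s r<..s (Suc r)}|lborel. lam \<tau>) * (g (s (Suc r)) - 1))"
    by (rule arrivals_increments_pgf) (use s g in auto)
  also have "(\<Sum>r<n. (LINT \<tau>:{s r<..s (Suc r)}|lborel. lam \<tau>) * (g (s (Suc r)) - 1))
      = (\<Sum>r<n. LINT \<tau>:{s r<..s (Suc r)}|lborel. lam \<tau> * (g \<tau> - 1))"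
  proof (intro sum.cong refl)
    fix r assume "r \<in> {..<n}"
    then have const: "g x = g (s (Suc r))" if "x \<in> {s r<..s (Suc r)}" for x
      using step that by blast
    have "(LINT \<tau>:{s r<..s (Suc r)}|lborel. lam \<tau> * (g \<tau> - 1))
        = (LINT \<tau>:{s r<..s (Suc r)}|lborel. lam \<tau> * (g (s (Suc r)) - 1))"
      by (rule set_lebesgue_integral_cong) (simp, metis const)
    then show "(LINT \<tau>:{s r<..s (Suc r)}|lborel. lam \<tau>) * (g (s (Suc r)) - 1)
        = (LINT \<tau>:{s r<..s (Suc r)}|lborel. lam \<tau> * (g \<tau> - 1))" by simp
  qed
  also have "\<dots> = (LINT \<tau>:(\<Union>r<n. {s r<..s (Suc r)})|lborel. lam \<tau> * (g \<tau> - 1))"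
  proof (rule set_integral_finite_Union[symmetric])
    show "disjoint_family_on (\<lambda>r. {s r<..s (Suc r)}) {..<n}"
      unfolding disjoint_family_on_def using consecutive_intervals_disjoint[OF s(2)] by blast
    fix r
    show "set_integrable lborel {s r<..s (Suc r)} (\<lambda>\<tau>. lam \<tau> * (g \<tau> - 1))"
    proof (rule rate_times_bounded_integrable[where C = 1])
      show "{s r<..s (Suc r)} \<subseteq> {0..s (Suc r)}" using s incseqD[OF s(2), of 0 r] by auto
      show "\<bar>g x - 1\<bar> \<le> 1" for x using g[of x] by auto
    qed auto
  qed auto
  also have "(\<Union>r<n. {s r<..s (Suc r)}) = {0<..t}"
    using consecutive_intervals_cover[OF s(2), of n] s by simp
  finally show ?thesis .
qed

text \<open>
  Almost surely the product has finitely many factors, hence it converges with the function; both sides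
  are dominated, the product by \<open>1\<close> and the integrand by \<open>\<bar>\<lambda>\<bar>\<close>.
\<close>

lemma poisson_product_functional_limit:
  assumes t: "0 \<le> t" and f: "\<And>m. f m \<in> borel_measurable borel" "\<And>m x. 0 \<le> f m x \<and> f m x \<le> 1"
    and lim: "\<And>x. (\<lambda>m. f m x) \<longlonglongrightarrow> g x"
    and eq: "\<And>m. expectation (arrival_product (f m) t)
      = exp (LINT \<tau>:{0<..t}|lborel. lam \<tau> * (f m \<tau> - 1))"
  shows "expectation (arrival_product g t) = exp (LINT \<tau>:{0<..t}|lborel. lam \<tau> * (g \<tau> - 1))"
proof -
  note [measurable] = f(1)
  have [measurable]: "g \<in> borel_measurable borel"
    by (rule borel_measurable_LIMSEQ_real[where u = f]) (use lim f in auto)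
  have lam: "set_integrable lborel {0<..t} lam"
    by (rule rate_set_integrable[of _ t]) auto
  then have [measurable]: "(\<lambda>\<tau>. indicator {0<..t} \<tau> * lam \<tau>) \<in> borel_measurable borel"
    by (auto simp: set_integrable_def)
  have "(\<lambda>m. expectation (arrival_product (f m) t)) \<longlonglongrightarrow> expectation (arrival_product g t)"
  proof (rule integral_dominated_convergence[where w = "\<lambda>_. 1"])
    show "AE \<omega> in M. (\<lambda>m. arrival_product (f m) t \<omega>) \<longlonglongrightarrow> arrival_product g t \<omega>"
      unfolding arrival_product_def by (intro AE_I2 tendsto_prod lim)
    show "AE \<omega> in M. norm (arrival_product (f m) t \<omega>) \<le> 1" for m
      using arrival_product_bounds[of "f m"] f(2) by (auto simp: abs_le_iff intro: order_trans[of _ 0])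
  qed auto
  moreover have "(\<lambda>m. exp (LINT \<tau>:{0<..t}|lborel. lam \<tau> * (f m \<tau> - 1)))
      \<longlonglongrightarrow> exp (LINT \<tau>:{0<..t}|lborel. lam \<tau> * (g \<tau> - 1))"
    unfolding set_lebesgue_integral_def real_scaleR_def mult.assoc[symmetric]
  proof (intro tendsto_exp integral_dominated_convergence[where w = "\<lambda>\<tau>. \<bar>indicator {0<..t} \<tau> * lam \<tau>\<bar>"])
    show "integrable lborel (\<lambda>\<tau>. \<bar>indicator {0<..t} \<tau> * lam \<tau>\<bar>)"
      using lam by (auto simp: set_integrable_def)
    show "AE \<tau> in lborel. (\<lambda>m. indicator {0<..t} \<tau> * lam \<tau> * (f m \<tau> - 1))
        \<longlonglongrightarrow> indicator {0<..t} \<tau> * lam \<tau> * (g \<tau> - 1)"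
      by (intro AE_I2 tendsto_intros lim)
    show "AE \<tau> in lborel. norm (indicator {0<..t} \<tau> * lam \<tau> * (f m \<tau> - 1))
        \<le> \<bar>indicator {0<..t} \<tau> * lam \<tau>\<bar>" for m
    proof (rule AE_I2)
      fix \<tau>
      have "\<bar>f m \<tau> - 1\<bar> \<le> 1" using f(2)[of m \<tau>] by auto
      then show "norm (indicator {0<..t} \<tau> * lam \<tau> * (f m \<tau> - 1)) \<le> \<bar>indicator {0<..t} \<tau> * lam \<tau>\<bar>"
        unfolding real_norm_def abs_mult[of _ "f m \<tau> - 1"] by (rule mult_left_le) simp
    qed
  qed measurable
  ultimately show ?thesis
    unfolding eq by (rule LIMSEQ_unique)
qed

text \<open>
  A continuous \<open>g\<close> is the limit of the step functions that evaluate \<open>g\<close> at the right end point of the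
  interval of length \<open>t / (m + 1)\<close> that contains the argument.
\<close>

lemma poisson_product_functional_continuous:
  assumes t: "0 \<le> t" and g: "continuous_on UNIV g" "\<And>x. 0 \<le> g x \<and> g x \<le> 1"
  shows "expectation (arrival_product g t) = exp (LINT \<tau>:{0<..t}|lborel. lam \<tau> * (g \<tau> - 1))"
proof (cases "t = 0")
  case True
  have "AE \<omega> in M. arrival_product g t \<omega> = 1"
    using AE_finitely_many_positive_arrivals
  proof eventually_elim
    case (elim \<omega>)
    then have "{i. T i \<omega> \<le> ereal t} = {}" using True by (auto simp: not_le zero_ereal_def)
    then show ?case by (simp add: arrival_product_def)
  qed
  then have "expectation (arrival_product g t) = expectation (\<lambda>_. 1)"
    using borel_measurable_continuous_onI[OF g(1)] by (intro integral_cong_AE) auto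
  then show ?thesis using True by (simp add: prob_space set_lebesgue_integral_def)
next
  case False
  with t have t: "0 < t" by simp
  have [measurable]: "g \<in> borel_measurable borel" using g(1) by (rule borel_measurable_continuous_onI)
  define up where "up m x = t * of_int \<lceil>x * real (Suc m) / t\<rceil> / real (Suc m)" for m x
  have up: "x \<le> up m x" "up m x \<le> x + t * (1 / real (Suc m))" for m x
  proof -
    define y where "y = x * real (Suc m) / t"
    have x: "x = t * y / real (Suc m)" using t by (simp add: y_def)
    have "y \<le> of_int \<lceil>y\<rceil>" "of_int \<lceil>y\<rceil> \<le> y + 1" by linarith+
    then have "t * y / real (Suc m) \<le> t * of_int \<lceil>y\<rceil> / real (Suc m)"
      "t * of_int \<lceil>y\<rceil> / real (Suc m) \<le> t * (y + 1) / real (Suc m)"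
      using t by (auto intro!: divide_right_mono mult_left_mono)
    then show "x \<le> up m x" "up m x \<le> x + t * (1 / real (Suc m))"
      unfolding up_def y_def[symmetric] by (simp_all add: x distrib_left add_divide_distrib)
  qed
  have up_lim: "(\<lambda>m. up m x) \<longlonglongrightarrow> x" for x
  proof (rule tendsto_sandwich[where f = "\<lambda>_. x"])
    show "(\<lambda>m. x + t * (1 / real (Suc m))) \<longlonglongrightarrow> x"
      using tendsto_add[OF tendsto_const[of x] tendsto_mult_left[OF LIMSEQ_Suc[OF lim_1_over_n]], of t]
      by simp
  qed (use up in auto)
  show ?thesis
  proof (rule poisson_product_functional_limit[where f = "\<lambda>m x. g (up m x)"])
    show "(\<lambda>m. g (up m x)) \<longlonglongrightarrow> g x" for x
      by (rule continuous_on_tendsto_compose[OF g(1) up_lim]) auto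
    fix m
    show up_meas: "(\<lambda>x. g (up m x)) \<in> borel_measurable borel"
      unfolding up_def by measurable
    define s where "s r = t * real (min r (Suc m)) / real (Suc m)" for r
    have up_s: "up m x = s (Suc r)" if "r < Suc m" "x \<in> {s r<..s (Suc r)}" for r x
    proof -
      have "real r < x * real (Suc m) / t" "x * real (Suc m) / t \<le> real (Suc r)"
        using that t by (auto simp: s_def field_simps)
      then have "\<lceil>x * real (Suc m) / t\<rceil> = int (Suc r)" by linarith
      then show ?thesis using that by (simp add: up_def s_def)
    qed
    show "expectation (arrival_product (\<lambda>x. g (up m x)) t)
        = exp (LINT \<tau>:{0<..t}|lborel. lam \<tau> * (g (up m \<tau>) - 1))"
    proof (rule poisson_product_functional_step[where s = s and n = "Suc m"])
      show "s 0 = 0" "s (Suc m) = t" by (simp_all add: s_def)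
      show mono: "incseq s"
        using t by (auto simp: incseq_def s_def intro!: divide_right_mono mult_left_mono)
      show "g (up m x) = g (up m (s (Suc r)))" if "r < Suc m" "x \<in> {s r<..s (Suc r)}" for r x
      proof -
        have "s r < s (Suc r)" using that by auto
        then show ?thesis using up_s[OF that] up_s[OF that(1), of "s (Suc r)"] by simp
      qed
    qed (use g up_meas in auto)
  qed (use t g in auto)
qed

text \<open>
  The Laplace functional of the Poisson process, written for \<open>g = exp (- f)\<close>.
\<close>

theorem poisson_product_functional:
  assumes t: "0 \<le> t" and g: "g \<in> borel_measurable borel" "\<And>x. 0 \<le> g x" "\<And>x. g x \<le> 1"
  shows "expectation (arrival_product g t) = exp (LINT \<tau>:{0<..t}|lborel. lam \<tau> * (g \<tau> - 1))"
  using baire_borel[OF g]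
proof induction
  case (continuous g)
  then show ?case using poisson_product_functional_continuous[OF t] by blast
next
  case (limit f g)
  then show ?case
    using baire_properties by (intro poisson_product_functional_limit[OF t, of f g]) auto
qed

end

section \<open>Independence of the sources of randomness\<close>

lemma (in prob_space) indep_sets_reindex:
  assumes "inj_on f A" "indep_sets F (f ` A)"
  shows "indep_sets (\<lambda>x. F (f x)) A"
proof (rule indep_setsI)
  fix i assume "i \<in> A"
  then show "F (f i) \<subseteq> events" using assms(2) by (auto simp: indep_sets_def)
next
  fix E K assume K: "K \<noteq> {}" "K \<subseteq> A" "finite K" and E: "\<forall>j\<in>K. E j \<in> F (f j)"
  define E' where "E' s = E (inv_into A f s)" for s
  have E': "E' (f j) = E j" if "j \<in> K" for j
    using that K assms(1) by (auto simp: E'_def)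
  have inj: "inj_on f K" using K(2) assms(1) inj_on_subset by blast
  have "prob (\<Inter>s\<in>f ` K. E' s) = (\<Prod>s\<in>f ` K. prob (E' s))"
    by (rule indep_setsD[OF assms(2)]) (use K E E' in auto)
  then show "prob (\<Inter> (E ` K)) = (\<Prod>j\<in>K. prob (E j))"
    using E' by (simp add: prod.reindex[OF inj])
qed

text \<open>
  Independence says that the joint law is the product of the marginals, so the variables may be
  integrated one after the other, the inner one over its own copy \<open>\<omega>'\<close> of the sample point.
\<close>

lemma (in prob_space) indep_var_expectation_fubini:
  fixes f :: "'b \<Rightarrow> 'b \<Rightarrow> real"
  assumes indep: "indep_var N1 U N2 V"
    and f [measurable]: "case_prod f \<in> borel_measurable (N1 \<Otimes>\<^sub>M N2)"
    and bound: "\<And>x y. \<bar>f x y\<bar> \<le> C"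
  shows "expectation (\<lambda>\<omega>. f (U \<omega>) (V \<omega>)) = expectation (\<lambda>\<omega>. expectation (\<lambda>\<omega>'. f (U \<omega>) (V \<omega>')))"
proof -
  have UV [measurable]: "U \<in> measurable M N1" "V \<in> measurable M N2"
    and prod: "distr M N1 U \<Otimes>\<^sub>M distr M N2 V = distr M (N1 \<Otimes>\<^sub>M N2) (\<lambda>\<omega>. (U \<omega>, V \<omega>))"
    using indep by (auto simp: indep_var_distribution_eq)
  interpret D1: prob_space "distr M N1 U" by (rule prob_space_distr) simp
  interpret D2: prob_space "distr M N2 V" by (rule prob_space_distr) simp
  interpret D: pair_prob_space "distr M N1 U" "distr M N2 V" ..
  have int: "integrable (distr M N1 U \<Otimes>\<^sub>M distr M N2 V) (case_prod f)"
    by (rule D.P.integrable_const_bound[where B = C]) (use bound in auto)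
  have "expectation (\<lambda>\<omega>. f (U \<omega>) (V \<omega>))
      = integral\<^sup>L (distr M (N1 \<Otimes>\<^sub>M N2) (\<lambda>\<omega>. (U \<omega>, V \<omega>))) (case_prod f)"
    by (subst integral_distr) auto
  also have "\<dots> = (\<integral>x. (\<integral>y. f x y \<partial>distr M N2 V) \<partial>distr M N1 U)"
    using D.integral_fst'[OF int] by (simp add: prod)
  also have "\<dots> = expectation (\<lambda>\<omega>. \<integral>y. f (U \<omega>) y \<partial>distr M N2 V)"
  proof (rule integral_distr)
    have "case_prod f \<in> borel_measurable (N1 \<Otimes>\<^sub>M distr M N2 V)"
      using f by (simp cong: measurable_cong_sets)
    then show "(\<lambda>x. \<integral>y. f x y \<partial>distr M N2 V) \<in> borel_measurable N1"
      by (rule D2.borel_measurable_lebesgue_integral)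
  qed simp
  also have "\<dots> = expectation (\<lambda>\<omega>. expectation (\<lambda>\<omega>'. f (U \<omega>) (V \<omega>')))"
  proof (intro Bochner_Integration.integral_cong refl integral_distr)
    fix \<omega> assume "\<omega> \<in> space M"
    then have "U \<omega> \<in> space N1" by (rule measurable_space[OF UV(1)])
    then show "f (U \<omega>) \<in> borel_measurable N2"
      using measurable_compose[OF measurable_Pair1' f] by simp
  qed simp
  finally show ?thesis .
qed

context batch_network
begin

sublocale poisson_process M lam T
  by unfold_locales (use rate_integrable arrival_times in auto)

definition customers :: "source set" where
  "customers = {Customer i j l | i j l. j \<in> {1..J}}"

text \<open>
  Encoded as a measure space on the sample space itself, so that the identity map is a random variable
  with values in it.
\<close>

definition revealed :: "source set \<Rightarrow> 'w measure" where
  "revealed S = sigma (space M) (\<Union>s\<in>S. sets (source_algebra M J T Sig X s))"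

lemma space_source_algebra: "space (source_algebra M J T Sig X s) = space M"
  by (cases s) (simp_all add: path_algebra_def)

lemma sets_revealed:
  "sets (revealed S) = sigma_sets (space M) (\<Union>s\<in>S. sets (source_algebra M J T Sig X s))"
proof -
  have "(\<Union>s\<in>S. sets (source_algebra M J T Sig X s)) \<subseteq> Pow (space M)"
    using sets.sets_into_space space_source_algebra by blast
  then show ?thesis by (simp add: revealed_def)
qed

lemma space_revealed [simp]: "space (revealed S) = space M"
proof -
  have "(\<Union>s\<in>S. sets (source_algebra M J T Sig X s)) \<subseteq> Pow (space M)"
    using sets.sets_into_space space_source_algebra by blast
  then show ?thesis by (simp add: revealed_def space_measure_of)
qed

lemma measurable_revealed:
  assumes "s \<in> S" "f \<in> measurable (source_algebra M J T Sig X s) N"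
  shows "f \<in> measurable (revealed S) N"
proof -
  have "sets (source_algebra M J T Sig X s) \<subseteq> sets (revealed S)"
    unfolding sets_revealed using assms(1) by (auto intro: sigma_sets.Basic)
  then show ?thesis
    using assms(2) by (auto simp: measurable_def space_source_algebra)
qed

lemma source_events:
  assumes "s \<in> {Arrivals} \<union> range Batch \<union> customers"
  shows "sets (source_algebra M J T Sig X s) \<subseteq> events"
  using sources_indep assms unfolding indep_sets_def customers_def by blast

lemma measurable_from_source:
  assumes "s \<in> {Arrivals} \<union> range Batch \<union> customers" "f \<in> measurable (source_algebra M J T Sig X s) N"
  shows "f \<in> measurable M N"
  using assms(2) source_events[OF assms(1)] by (auto simp: measurable_def space_source_algebra)

lemma indep_vars_sources:
  assumes "inj_on f A" "f ` A \<subseteq> {Arrivals} \<union> range Batch \<union> customers"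
    and V: "\<And>a. a \<in> A \<Longrightarrow> V a \<in> measurable (source_algebra M J T Sig X (f a)) (N a)"
  shows "indep_vars N V A"
  unfolding indep_vars_def2
proof (intro conjI ballI)
  show "V a \<in> measurable M (N a)" if "a \<in> A" for a
    using measurable_from_source[OF _ V[OF that]] that assms(2) by blast
  have "indep_sets (\<lambda>a. sets (source_algebra M J T Sig X (f a))) A"
    using indep_sets_reindex[OF assms(1) indep_sets_mono_index[OF assms(2)]] sources_indep
    by (simp add: customers_def)
  then show "indep_sets (\<lambda>a. {V a -` E \<inter> space M | E. E \<in> sets (N a)}) A"
  proof (rule indep_sets_mono_sets)
    fix a assume "a \<in> A"
    then show "{V a -` E \<inter> space M | E. E \<in> sets (N a)} \<subseteq> sets (source_algebra M J T Sig X (f a))"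
      using measurable_sets[OF V] by (auto simp: space_source_algebra)
  qed
qed

text \<open>
  With the identity map, seen as two random variables, Fubini's theorem applies to any expression in \<open>\<omega>\<close> and \<open>\<omega>'\<close> that depends on \<open>\<omega>\<close> through the first group of
  sources and on \<open>\<omega>'\<close> through the second.
\<close>

lemma indep_revealed:
  assumes "S1 \<inter> S2 = {}" "S1 \<union> S2 \<subseteq> {Arrivals} \<union> range Batch \<union> customers"
  shows "indep_var (revealed S1) (\<lambda>\<omega>. \<omega>) (revealed S2) (\<lambda>\<omega>. \<omega>)"
proof -
  have id: "(\<lambda>\<omega>. \<omega>) \<in> measurable M (revealed S)"
    if "S \<subseteq> {Arrivals} \<union> range Batch \<union> customers" for S
  proof (unfold revealed_def, rule measurable_measure_of)
    show "(\<Union>s\<in>S. sets (source_algebra M J T Sig X s)) \<subseteq> Pow (space M)"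
      using sets.sets_into_space space_source_algebra by blast
    fix E assume "E \<in> (\<Union>s\<in>S. sets (source_algebra M J T Sig X s))"
    then have "E \<in> events" using source_events that by blast
    then show "(\<lambda>\<omega>. \<omega>) -` E \<inter> space M \<in> events" by simp
  qed simp
  have "indep_sets (\<lambda>s. sets (source_algebra M J T Sig X s)) (\<Union>b\<in>UNIV. case_bool S1 S2 b)"
    by (rule indep_sets_mono_index[OF _ sources_indep]) (use assms(2) in \<open>auto simp: UNIV_bool customers_def\<close>)
  then have "indep_sets (\<lambda>b. sigma_sets (space M)
      (\<Union>s\<in>case_bool S1 S2 b. sets (source_algebra M J T Sig X s))) UNIV"
    by (rule indep_sets_collect_sigma)
       (use assms(1) in \<open>auto simp: disjoint_family_on_def sets.Int_stable split: bool.splits\<close>)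
  then have "indep_sets (\<lambda>b. {case_bool (\<lambda>\<omega>. \<omega>) (\<lambda>\<omega>. \<omega>) b -` E \<inter> space M | E.
      E \<in> sets (case_bool (revealed S1) (revealed S2) b)}) UNIV"
  proof (rule indep_sets_mono_sets)
    fix b
    show "{case_bool (\<lambda>\<omega>. \<omega>) (\<lambda>\<omega>. \<omega>) b -` E \<inter> space M | E.
        E \<in> sets (case_bool (revealed S1) (revealed S2) b)}
      \<subseteq> sigma_sets (space M) (\<Union>s\<in>case_bool S1 S2 b. sets (source_algebra M J T Sig X s))"
    proof -
      have "E \<inter> space M = E" if "E \<in> sets (revealed S)" for E S
        using sets.sets_into_space[OF that] by auto
      then show ?thesis by (cases b) (auto simp: sets_revealed)
    qed
  qed
  then show ?thesis
    unfolding indep_var_def indep_vars_def2 using id assms(2) by (auto split: bool.split)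
qed

lemma arrival_time_revealed:
  assumes "Arrivals \<in> S"
  shows "T i \<in> borel_measurable (revealed S)"
proof (rule measurable_revealed[OF assms])
  have "(\<lambda>\<omega> i. T i \<omega>) \<in> measurable (source_algebra M J T Sig X Arrivals) (PiM UNIV (\<lambda>_. borel))"
    by (auto intro!: measurable_vimage_algebra1 simp: space_PiM)
  from measurable_compose[OF this measurable_component_singleton, of i]
  show "T i \<in> borel_measurable (source_algebra M J T Sig X Arrivals)" by simp
qed

lemma batch_size_measurable:
  assumes "j \<in> {1..J}"
  shows "Sig i j \<in> measurable (source_algebra M J T Sig X (Batch i)) (count_space UNIV)"
proof -
  have "batch_vector J Sig i
      \<in> measurable (source_algebra M J T Sig X (Batch i)) (PiM {1..J} (\<lambda>_. count_space UNIV))"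
    unfolding source_algebra.simps
    by (rule measurable_vimage_algebra1) (auto simp: space_PiM batch_vector_def)
  from measurable_compose[OF this measurable_component_singleton, of j]
  show ?thesis using assms by (simp add: batch_vector_def)
qed

lemma batch_size_revealed:
  assumes "Batch i \<in> S" "j \<in> {1..J}"
  shows "Sig i j \<in> measurable (revealed S) (count_space UNIV)"
  using measurable_revealed[OF assms(1) batch_size_measurable[OF assms(2)]] .

text \<open>
  Here the joint measurability of the path in time and sample point is used: the age is random, but it
  depends on another coordinate than the path.
\<close>

lemma position_at_random_age:
  assumes j: "j \<in> {1..J}" and h: "h \<in> borel_measurable N" "\<And>x. 0 \<le> h x"
    and path: "(\<lambda>\<omega>. \<omega>) \<in> measurable N' (path_algebra M (X i j l))"
  shows "(\<lambda>x. X i j l (h (fst x)) (snd x)) \<in> measurable (N \<Otimes>\<^sub>M N') (count_space UNIV)"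
proof -
  have "(\<lambda>x. (h (fst x), snd x)) \<in> measurable (N \<Otimes>\<^sub>M N')
      (restrict_space borel {0..} \<Otimes>\<^sub>M path_algebra M (X i j l))"
    using h measurable_compose[OF measurable_fst h(1)] measurable_compose[OF measurable_snd path]
    by (intro measurable_Pair measurable_restrict_space2) (auto simp: comp_def)
  from measurable_compose[OF this path_measurable[OF j]]
  show ?thesis by simp
qed

lemma path_revealed:
  assumes "Customer i j l \<in> S"
  shows "(\<lambda>\<omega>. \<omega>) \<in> measurable (revealed S) (path_algebra M (X i j l))"
  by (rule measurable_revealed[OF assms]) simp

end

section \<open>The joint generating function of the queue lengths\<close>

lemma pgf_measurable [measurable]: "pgf B \<in> borel_measurable borel"
proof -
  have "(\<lambda>(z::real, s). z ^ s) \<in> borel_measurable (borel \<Otimes>\<^sub>M measure_pmf B)"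
  proof -
    have "(\<lambda>x. fst x ^ snd x :: real) \<in> borel_measurable (borel \<Otimes>\<^sub>M measure_pmf B)"
    proof (rule measurable_compose_countable[where g = snd and f = "\<lambda>s x. fst x ^ s"])
      show "snd \<in> measurable (borel \<Otimes>\<^sub>M measure_pmf B) (count_space UNIV)"
        using measurable_snd[of borel "measure_pmf B"] by simp
    qed measurable
    then show ?thesis unfolding split_beta' .
  qed
  then show ?thesis
    unfolding pgf_def[abs_def] by (rule measure_pmf.borel_measurable_lebesgue_integral)
qed

lemma pgf_bounds:
  assumes "0 \<le> z" "z \<le> 1"
  shows "0 \<le> pgf B z" "pgf B z \<le> 1"
proof -
  show "0 \<le> pgf B z" unfolding pgf_def using assms by (intro integral_nonneg_AE) auto
  have "pgf B z \<le> measure_pmf.expectation B (\<lambda>_. 1)"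
    unfolding pgf_def
  proof (rule integral_mono)
    show "integrable (measure_pmf B) ((^) z)"
      by (rule measure_pmf.integrable_const_bound[where B = 1]) (use assms in \<open>auto simp: power_le_one\<close>)
  qed (use assms in \<open>auto simp: power_le_one\<close>)
  then show "pgf B z \<le> 1" by simp
qed

lemma power_card_eq_prod:
  fixes c :: "'a :: comm_monoid_mult"
  assumes "finite A"
  shows "c ^ card {x \<in> A. P x} = (\<Prod>x\<in>A. if P x then c else 1)"
  using assms by (simp add: prod.inter_filter[symmetric])

context batch_network
begin

text \<open>
  The truncation at \<open>0\<close> makes this a nonnegative number also for a batch that arrives after \<open>t\<close>, since
  positions and their probabilities are specified for nonnegative ages only.
\<close>

definition age :: "real \<Rightarrow> nat \<Rightarrow> 'w \<Rightarrow> real" where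
  "age t i \<omega> = max 0 (t - real_of_ereal (T i \<omega>))"

text \<open>
  A customer in queue \<open>k\<close> contributes the factor \<open>z k\<close>, and one who has left the network the factor \<open>1\<close>.
\<close>

definition mark :: "(nat \<Rightarrow> real) \<Rightarrow> nat \<Rightarrow> real" where
  "mark z k = (if k \<in> {1..J} then z k else 1)"

text \<open>
  The expected mark, a time \<open>u\<close> after arrival, of a customer who entered at queue \<open>j\<close>; the indicator
  makes it Borel measurable on the whole line.
\<close>

definition mean_mark :: "(nat \<Rightarrow> real) \<Rightarrow> nat \<Rightarrow> real \<Rightarrow> real" where
  "mean_mark z j u = 1 - (\<Sum>k=1..J. indicator {0..} u * q j k u * (1 - z k))"

lemma age_nonneg [simp]: "0 \<le> age t i \<omega>"
  by (simp add: age_def)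

lemma age_eq: "T i \<omega> \<le> ereal t \<Longrightarrow> 0 \<le> t \<Longrightarrow> age t i \<omega> = t - real_of_ereal (T i \<omega>)"
  by (cases "T i \<omega>") (auto simp: age_def)

lemma age_measurable:
  assumes [measurable]: "T i \<in> borel_measurable N"
  shows "age t i \<in> borel_measurable N"
  unfolding age_def[abs_def] by measurable

lemma position_measurable_at_age:
  assumes "j \<in> {1..J}"
  shows "(\<lambda>\<omega>. X i j l (age t i \<omega>) \<omega>) \<in> measurable M (count_space UNIV)"
proof -
  have "(\<lambda>\<omega>. \<omega>) \<in> measurable M (path_algebra M (X i j l))"
  proof (rule measurable_from_source)
    show "Customer i j l \<in> {Arrivals} \<union> range Batch \<union> customers"
      unfolding customers_def using assms by blast
    show "(\<lambda>\<omega>. \<omega>) \<in> measurable (source_algebra M J T Sig X (Customer i j l)) (path_algebra M (X i j l))"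
      unfolding source_algebra.simps by (rule measurable_ident_sets) simp
  qed
  then have "(\<lambda>x. X i j l (age t i (fst x)) (snd x)) \<in> measurable (M \<Otimes>\<^sub>M M) (count_space UNIV)"
    by (intro position_at_random_age assms age_measurable arrival_time_measurable age_nonneg)
  from measurable_compose[OF _ this, of "\<lambda>\<omega>. (\<omega>, \<omega>)" M] show ?thesis by simp
qed

text \<open>
  The random set of customers that is counted is encoded as a random set of natural numbers,
  whose cardinality is measurable as soon as membership of each number is.
\<close>

lemma queue_length_measurable [measurable]:
  assumes "0 \<le> t"
  shows "queue_length J T Sig X k t \<in> measurable M (count_space UNIV)"
proof -
  define S where "S \<omega> = {(i, j, l). T i \<omega> \<le> ereal t \<and> j \<in> {1..J} \<and> l < Sig i j \<omega> \<and>
      X i j l (t - real_of_ereal (T i \<omega>)) \<omega> = k}" for \<omega>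
  have mem: "{\<omega> \<in> space M. x \<in> S \<omega>} \<in> events" for x
  proof (cases x)
    case (fields i j l)
    show ?thesis
    proof (cases "j \<in> {1..J}")
      case True
      note [measurable] = position_measurable_at_age[OF True] batch_measurable[OF True]
      have "{\<omega> \<in> space M. x \<in> S \<omega>}
          = {\<omega> \<in> space M. T i \<omega> \<le> ereal t \<and> l < Sig i j \<omega> \<and> X i j l (age t i \<omega>) \<omega> = k}"
        using fields True assms by (auto simp: S_def age_eq)
      also have "\<dots> \<in> events" by measurable
      finally show ?thesis .
    next
      case False
      then have "{\<omega> \<in> space M. x \<in> S \<omega>} = {}" unfolding fields S_def by blast
      then show ?thesis by (metis sets.empty_sets)
    qed
  qed
  have "to_nat ` S \<omega> = {r. from_nat r \<in> S \<omega> \<and> to_nat (from_nat r :: nat \<times> nat \<times> nat) = r}" for \<omega>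
    by (auto simp: image_iff) (metis)
  then have "queue_length J T Sig X k t \<omega>
      = card {r. from_nat r \<in> S \<omega> \<and> to_nat (from_nat r :: nat \<times> nat \<times> nat) = r}" for \<omega>
    unfolding queue_length_def S_def[symmetric] using card_image[OF inj_on_subset[OF inj_to_nat]]
    by (metis subset_UNIV)
  moreover have "(\<lambda>\<omega>. card {r. from_nat r \<in> S \<omega> \<and> to_nat (from_nat r :: nat \<times> nat \<times> nat) = r})
      \<in> measurable M (count_space UNIV)"
  proof (rule measurable_card)
    fix r
    show "{\<omega> \<in> space M. r \<in> {r. from_nat r \<in> S \<omega> \<and> to_nat (from_nat r :: nat \<times> nat \<times> nat) = r}} \<in> events"
      using mem[of "from_nat r"] by (cases "to_nat (from_nat r :: nat \<times> nat \<times> nat) = r") auto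
  qed
  ultimately show ?thesis by presburger
qed

lemma mark_bounds:
  assumes "\<And>k. k \<in> {1..J} \<Longrightarrow> 0 \<le> z k \<and> z k \<le> 1"
  shows "0 \<le> mark z k" "mark z k \<le> 1"
  using assms by (auto simp: mark_def)

lemma mark_eq: "mark z x = 1 - (\<Sum>k=1..J. of_bool (x = k) * (1 - z k))"
proof -
  have "(\<Sum>k=1..J. of_bool (x = k) * (1 - z k)) = (\<Sum>k=1..J. if x = k then 1 - z k else 0)"
    by (intro sum.cong) auto
  then show ?thesis by (simp add: mark_def)
qed

lemma expectation_mark:
  assumes "j \<in> {1..J}" "0 \<le> u"
  shows "expectation (\<lambda>\<omega>. mark z (X i j l u \<omega>)) = mean_mark z j u"
proof -
  note [measurable] = position_measurable[OF assms]
  have prob: "expectation (\<lambda>\<omega>. of_bool (X i j l u \<omega> = k)) = q j k u" if "k \<in> {1..J}" for k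
  proof -
    have "expectation (\<lambda>\<omega>. of_bool (X i j l u \<omega> = k))
        = expectation (indicator {\<omega> \<in> space M. X i j l u \<omega> = k})"
      by (intro Bochner_Integration.integral_cong) (auto simp: indicator_def)
    also have "\<dots> = prob {\<omega> \<in> space M. X i j l u \<omega> = k}" by simp
    also have "\<dots> = q j k u" using position_prob[OF assms(1) that assms(2)] .
    finally show ?thesis .
  qed
  have int: "integrable M (\<lambda>\<omega>. of_bool (X i j l u \<omega> = k) :: real)" for k
    by (rule integrable_const_bound[where B = 1]) auto
  have "expectation (\<lambda>\<omega>. mark z (X i j l u \<omega>))
      = 1 - (\<Sum>k=1..J. expectation (\<lambda>\<omega>. of_bool (X i j l u \<omega> = k)) * (1 - z k))"
    unfolding mark_eq using int by (simp add: prob_space del: sum_of_bool_mult_eq)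
  also have "\<dots> = mean_mark z j u" using assms(2) by (simp add: mean_mark_def prob)
  finally show ?thesis .
qed

lemma mean_mark_bounds:
  assumes "j \<in> {1..J}" and z: "\<And>k. k \<in> {1..J} \<Longrightarrow> 0 \<le> z k \<and> z k \<le> 1"
  shows "0 \<le> mean_mark z j u" "mean_mark z j u \<le> 1"
proof -
  have "0 \<le> mean_mark z j u \<and> mean_mark z j u \<le> 1"
  proof (cases "0 \<le> u")
    case True
    note [measurable] = position_measurable[OF assms(1) True]
    have b: "0 \<le> mark z x" "mark z x \<le> 1" for x using mark_bounds[OF z] by auto
    have "mean_mark z j u = expectation (\<lambda>\<omega>. mark z (X 0 j 0 u \<omega>))"
      using expectation_mark[OF assms(1) True] by simp
    moreover have "integrable M (\<lambda>\<omega>. mark z (X 0 j 0 u \<omega>))"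
      by (rule integrable_const_bound[where B = 1]) (use b in auto)
    then have "expectation (\<lambda>\<omega>. mark z (X 0 j 0 u \<omega>)) \<le> expectation (\<lambda>\<omega>. 1)"
      by (intro integral_mono) (use b in auto)
    ultimately show ?thesis using b by (auto simp: prob_space intro!: integral_nonneg)
  qed (simp add: mean_mark_def)
  then show "0 \<le> mean_mark z j u" "mean_mark z j u \<le> 1" by auto
qed

lemma mean_mark_measurable:
  assumes "j \<in> {1..J}"
  shows "mean_mark z j \<in> borel_measurable borel"
proof -
  have "(\<lambda>u. indicator {0..} u * q j k u) \<in> borel_measurable borel" if "k \<in> {1..J}" for k
    using position_prob_measurable[OF assms that] by (simp add: set_borel_measurable_def)
  then show ?thesis
    unfolding mean_mark_def[abs_def] by measurable
qed

lemma expectation_batch_power: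
  assumes z: "\<And>j. j \<in> {1..J} \<Longrightarrow> 0 \<le> z j \<and> z j \<le> 1"
  shows "expectation (\<lambda>\<omega>. \<Prod>j=1..J. z j ^ Sig i j \<omega>) = pgf B (\<Sum>j=1..J. p j * z j)"
proof -
  have "batch_vector J Sig i \<in> measurable M (PiM {1..J} (\<lambda>_. count_space UNIV))"
    unfolding batch_vector_def by (rule measurable_restrict) (rule batch_measurable)
  moreover have "(\<lambda>S. \<Prod>j=1..J. z j ^ S j) \<in> borel_measurable (PiM {1..J} (\<lambda>_. count_space UNIV))"
  proof (rule borel_measurable_prod)
    fix j assume "j \<in> {1..J}"
    then show "(\<lambda>S. z j ^ S j) \<in> borel_measurable (PiM {1..J} (\<lambda>_. count_space UNIV))"
      by (intro measurable_compose[OF measurable_component_singleton]) auto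
  qed
  ultimately have "(LINT S|D. (\<Prod>j=1..J. z j ^ S j))
      = expectation (\<lambda>\<omega>. \<Prod>j=1..J. z j ^ batch_vector J Sig i \<omega> j)"
    unfolding batch_law[of i, symmetric] by (rule integral_distr)
  then show ?thesis using batch_pgf[OF z] by (simp add: batch_vector_def)
qed

lemma expectation_customers:
  assumes A: "finite A" "\<And>i j l. (i, j, l) \<in> A \<Longrightarrow> j \<in> {1..J}" and u: "\<And>i. 0 \<le> u i"
    and z: "\<And>k. k \<in> {1..J} \<Longrightarrow> 0 \<le> z k \<and> z k \<le> 1"
  shows "expectation (\<lambda>\<omega>. \<Prod>(i, j, l)\<in>A. mark z (X i j l (u i) \<omega>))
    = (\<Prod>(i, j, l)\<in>A. mean_mark z j (u i))"
proof -
  have "indep_vars (\<lambda>_. borel) (\<lambda>(i, j, l) \<omega>. mark z (X i j l (u i) \<omega>)) A"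
  proof (rule indep_vars_sources[where f = "\<lambda>(i, j, l). Customer i j l"])
    show "inj_on (\<lambda>(i, j, l). Customer i j l) A" by (auto simp: inj_on_def)
    show "(\<lambda>(i, j, l). Customer i j l) ` A \<subseteq> {Arrivals} \<union> range Batch \<union> customers"
      using A(2) by (auto simp: customers_def)
    fix a assume "a \<in> A"
    obtain i j l where a: "a = (i, j, l)" by (cases a)
    have "(\<lambda>\<omega>. \<lambda>u\<in>{0..}. X i j l u \<omega>)
        \<in> measurable (path_algebra M (X i j l)) (PiM {0..} (\<lambda>_. count_space UNIV))"
      unfolding path_algebra_def by (rule measurable_vimage_algebra1) (auto simp: space_PiM)
    from measurable_compose[OF this measurable_component_singleton, of "u i"] u[of i]
    have "(\<lambda>\<omega>. X i j l (u i) \<omega>) \<in> measurable (path_algebra M (X i j l)) (count_space UNIV)" by simp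
    then show "(case a of (i, j, l) \<Rightarrow> \<lambda>\<omega>. mark z (X i j l (u i) \<omega>))
        \<in> borel_measurable (source_algebra M J T Sig X (case a of (i, j, l) \<Rightarrow> Customer i j l))"
      unfolding a prod.case source_algebra.simps by (rule measurable_compose) simp
  qed
  then have "expectation (\<lambda>\<omega>. \<Prod>x\<in>A. (case x of (i, j, l) \<Rightarrow> \<lambda>\<omega>. mark z (X i j l (u i) \<omega>)) \<omega>)
      = (\<Prod>x\<in>A. expectation (\<lambda>\<omega>. (case x of (i, j, l) \<Rightarrow> \<lambda>\<omega>. mark z (X i j l (u i) \<omega>)) \<omega>))"
  proof (intro indep_vars_lebesgue_integral A(1))
    fix x assume "x \<in> A"
    then obtain i j l where x: "x = (i, j, l)" "j \<in> {1..J}" using A(2) by (cases x) auto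
    note [measurable] = position_measurable[OF x(2) u]
    show "integrable M ((case x of (i, j, l) \<Rightarrow> \<lambda>\<omega>. mark z (X i j l (u i) \<omega>)))"
      unfolding x by (simp, rule integrable_const_bound[where B = 1]) (use mark_bounds[OF z] in auto)
  qed
  also have "\<dots> = (\<Prod>(i, j, l)\<in>A. mean_mark z j (u i))"
    by (intro prod.cong) (use A(2) u in \<open>auto simp: expectation_mark\<close>)
  finally show ?thesis by (simp add: split_beta')
qed

definition unit_marks :: "(nat \<Rightarrow> real) \<Rightarrow> bool" where
  "unit_marks z \<longleftrightarrow> (\<forall>k\<in>{1..J}. 0 \<le> z k \<and> z k \<le> 1)"

text \<open>
  Once the arrival times and batch sizes are fixed, finitely many independent customers are
  observed at fixed ages, so the inner expectation factorizes.
\<close>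

lemma expectation_given_arrivals_and_batches:
  assumes t: "0 \<le> t" and z: "unit_marks z"
  shows "expectation (\<lambda>\<omega>. \<Prod>i<m. if T i \<omega> \<le> ereal t
        then \<Prod>j=1..J. \<Prod>l<Sig i j \<omega>. mark z (X i j l (age t i \<omega>) \<omega>) else 1)
    = expectation (\<lambda>\<omega>. \<Prod>i<m. if T i \<omega> \<le> ereal t
        then \<Prod>j=1..J. mean_mark z j (age t i \<omega>) ^ Sig i j \<omega> else 1)"
proof -
  let ?S = "{Arrivals} \<union> range Batch"
  define f where "f \<omega> \<omega>' = (\<Prod>i<m. if T i \<omega> \<le> ereal t
      then \<Prod>j=1..J. \<Prod>l<Sig i j \<omega>. mark z (X i j l (age t i \<omega>) \<omega>') else 1)" for \<omega> \<omega>'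
  have zb: "0 \<le> z k \<and> z k \<le> 1" if "k \<in> {1..J}" for k using z that by (simp add: unit_marks_def)
  note b = mark_bounds[of z, OF zb]
  have T_meas: "T i \<in> borel_measurable (revealed ?S)" for i
    by (rule arrival_time_revealed) simp
  have Sig_meas: "Sig i j \<in> measurable (revealed ?S) (count_space UNIV)" if "j \<in> {1..J}" for i j
    by (rule batch_size_revealed) (use that in auto)
  have X_meas: "(\<lambda>x. X i j l (age t i (fst x)) (snd x))
      \<in> measurable (revealed ?S \<Otimes>\<^sub>M revealed customers) (count_space UNIV)" if "j \<in> {1..J}" for i j l
  proof (rule position_at_random_age[OF that])
    show "(\<lambda>\<omega>. \<omega>) \<in> measurable (revealed customers) (path_algebra M (X i j l))"
      by (rule path_revealed) (use that in \<open>auto simp: customers_def\<close>)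
  qed (use T_meas in \<open>auto intro: age_measurable\<close>)
  have factor_meas: "(\<lambda>x. \<Prod>l<Sig i j (fst x). mark z (X i j l (age t i (fst x)) (snd x)))
      \<in> borel_measurable (revealed ?S \<Otimes>\<^sub>M revealed customers)" if j: "j \<in> {1..J}" for i j
  proof (rule measurable_compose_countable[where g = "\<lambda>x. Sig i j (fst x)"])
    show "(\<lambda>x. Sig i j (fst x)) \<in> measurable (revealed ?S \<Otimes>\<^sub>M revealed customers) (count_space UNIV)"
      by (rule measurable_compose[OF measurable_fst Sig_meas[OF j]])
    show "(\<lambda>x. \<Prod>l<r. mark z (X i j l (age t i (fst x)) (snd x)))
        \<in> borel_measurable (revealed ?S \<Otimes>\<^sub>M revealed customers)" for r
      by (intro borel_measurable_prod measurable_compose[OF X_meas[OF j], of "mark z"]) simp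
  qed
  have meas: "case_prod f \<in> borel_measurable (revealed ?S \<Otimes>\<^sub>M revealed customers)"
    unfolding f_def split_beta'
  proof (intro borel_measurable_prod measurable_If factor_meas measurable_const)
    fix i
    have [measurable]: "(\<lambda>x. T i (fst x)) \<in> borel_measurable (revealed ?S \<Otimes>\<^sub>M revealed customers)"
      by (rule measurable_compose[OF measurable_fst T_meas])
    show "{x \<in> space (revealed ?S \<Otimes>\<^sub>M revealed customers). T i (fst x) \<le> ereal t}
        \<in> sets (revealed ?S \<Otimes>\<^sub>M revealed customers)" by measurable
  qed auto
  have bound: "\<bar>f \<omega> \<omega>'\<bar> \<le> 1" for \<omega> \<omega>'
  proof -
    have "0 \<le> f \<omega> \<omega>'" unfolding f_def by (intro prod_nonneg ballI) (auto intro!: prod_nonneg b)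
    moreover have "f \<omega> \<omega>' \<le> 1"
      unfolding f_def by (intro prod_le_1) (auto intro!: prod_nonneg prod_le_1 b)
    ultimately show ?thesis by simp
  qed
  have "indep_var (revealed ?S) (\<lambda>\<omega>. \<omega>) (revealed customers) (\<lambda>\<omega>. \<omega>)"
    by (rule indep_revealed) (auto simp: customers_def)
  from indep_var_expectation_fubini[OF this meas bound]
  have "expectation (\<lambda>\<omega>. f \<omega> \<omega>) = expectation (\<lambda>\<omega>. expectation (\<lambda>\<omega>'. f \<omega> \<omega>'))" .
  moreover have "expectation (\<lambda>\<omega>'. f \<omega> \<omega>') = (\<Prod>i<m. if T i \<omega> \<le> ereal t
        then \<Prod>j=1..J. mean_mark z j (age t i \<omega>) ^ Sig i j \<omega> else 1)" for \<omega>
  proof -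
    define A where "A = (SIGMA i:{i\<in>{..<m}. T i \<omega> \<le> ereal t}. SIGMA j:{1..J}. {..<Sig i j \<omega>})"
    have nested: "(\<Prod>i<m. if T i \<omega> \<le> ereal t then \<Prod>j=1..J. \<Prod>l<Sig i j \<omega>. h i j l else 1)
        = (\<Prod>(i, j, l)\<in>A. h i j l)" for h :: "nat \<Rightarrow> nat \<Rightarrow> nat \<Rightarrow> real"
      unfolding A_def by (simp add: prod.inter_filter[symmetric] prod.Sigma)
    have "expectation (\<lambda>\<omega>'. f \<omega> \<omega>')
        = expectation (\<lambda>\<omega>'. \<Prod>(i, j, l)\<in>A. mark z (X i j l (age t i \<omega>) \<omega>'))"
      unfolding f_def nested ..
    also have "\<dots> = (\<Prod>(i, j, l)\<in>A. mean_mark z j (age t i \<omega>))"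
    proof (rule expectation_customers)
      show "finite A" unfolding A_def by (intro finite_SigmaI) auto
    qed (use zb in \<open>auto simp: A_def\<close>)
    also have "\<dots> = (\<Prod>i<m. if T i \<omega> \<le> ereal t
        then \<Prod>j=1..J. mean_mark z j (age t i \<omega>) ^ Sig i j \<omega> else 1)"
      by (simp only: nested[symmetric] prod_constant card_lessThan cong: if_cong)
    finally show ?thesis .
  qed
  ultimately show ?thesis by (simp add: f_def)
qed

text \<open>
  The generating function, at the marks \<open>z\<close>, of the vector of customers that a batch of age \<open>u\<close> has in
  the queues.
\<close>

definition batch_transform :: "(nat \<Rightarrow> real) \<Rightarrow> real \<Rightarrow> real" where
  "batch_transform z u = pgf B (\<Sum>j=1..J. p j * mean_mark z j u)"

lemma entry_average_bounds:
  assumes "\<And>j. j \<in> {1..J} \<Longrightarrow> 0 \<le> w j \<and> w j \<le> 1"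
  shows "0 \<le> (\<Sum>j=1..J. p j * w j)" "(\<Sum>j=1..J. p j * w j) \<le> 1"
proof -
  show "0 \<le> (\<Sum>j=1..J. p j * w j)"
    using assms entry_prob_nonneg by (intro sum_nonneg mult_nonneg_nonneg) auto
  have "(\<Sum>j=1..J. p j * w j) \<le> (\<Sum>j=1..J. p j)"
    using assms entry_prob_nonneg by (intro sum_mono mult_left_le) auto
  then show "(\<Sum>j=1..J. p j * w j) \<le> 1" using entry_prob_sum by simp
qed

lemma batch_transform_bounds:
  assumes "unit_marks z"
  shows "0 \<le> batch_transform z u" "batch_transform z u \<le> 1"
  unfolding batch_transform_def
  using assms mean_mark_bounds[of _ z u] entry_average_bounds[of "\<lambda>j. mean_mark z j u"]
  by (auto simp: unit_marks_def intro!: pgf_bounds)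

lemma batch_transform_measurable: "batch_transform z \<in> borel_measurable borel"
proof -
  have "(\<lambda>u. \<Sum>j=1..J. p j * mean_mark z j u) \<in> borel_measurable borel"
    by (intro borel_measurable_sum borel_measurable_times mean_mark_measurable) auto
  from measurable_compose[OF this pgf_measurable[of B]]
  show ?thesis by (simp add: batch_transform_def[abs_def])
qed

text \<open>
  Once the arrival times are fixed, the batches are independent, and the generating function of
  the batch vector, evaluated at the mean marks, gives the factor of each batch.
\<close>

lemma expectation_given_arrivals:
  assumes t: "0 \<le> t" and z: "unit_marks z"
  shows "expectation (\<lambda>\<omega>. \<Prod>i<m. if T i \<omega> \<le> ereal t
        then \<Prod>j=1..J. mean_mark z j (age t i \<omega>) ^ Sig i j \<omega> else 1)
    = expectation (\<lambda>\<omega>. \<Prod>i<m. if T i \<omega> \<le> ereal t then batch_transform z (age t i \<omega>) else 1)"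
proof -
  define g where "g i \<omega> \<omega>' = (if T i \<omega> \<le> ereal t
      then \<Prod>j=1..J. mean_mark z j (age t i \<omega>) ^ Sig i j \<omega>' else 1)" for i \<omega> \<omega>'
  have b: "0 \<le> mean_mark z j u \<and> mean_mark z j u \<le> 1" if "j \<in> {1..J}" for j u
    using mean_mark_bounds[OF that, of z] z by (auto simp: unit_marks_def)
  have T_meas: "T i \<in> borel_measurable (revealed {Arrivals})" for i
    by (rule arrival_time_revealed) simp
  have Sig_meas: "Sig i j \<in> measurable (revealed (range Batch)) (count_space UNIV)" if "j \<in> {1..J}" for i j
    by (rule batch_size_revealed) (use that in auto)
  have factor_meas: "(\<lambda>x. mean_mark z j (age t i (fst x)) ^ Sig i j (snd x))
      \<in> borel_measurable (revealed {Arrivals} \<Otimes>\<^sub>M revealed (range Batch))" if j: "j \<in> {1..J}" for i j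
  proof (rule measurable_compose_countable[where g = "\<lambda>x. Sig i j (snd x)"])
    show "(\<lambda>x. Sig i j (snd x)) \<in> measurable (revealed {Arrivals} \<Otimes>\<^sub>M revealed (range Batch)) (count_space UNIV)"
      by (rule measurable_compose[OF measurable_snd Sig_meas[OF j]])
    show "(\<lambda>x. mean_mark z j (age t i (fst x)) ^ r)
        \<in> borel_measurable (revealed {Arrivals} \<Otimes>\<^sub>M revealed (range Batch))" for r
      by (intro borel_measurable_power measurable_compose[OF _ mean_mark_measurable[OF j]]
          measurable_compose[OF measurable_fst] age_measurable T_meas)
  qed
  have meas: "(\<lambda>(\<omega>, \<omega>'). \<Prod>i<m. g i \<omega> \<omega>')
      \<in> borel_measurable (revealed {Arrivals} \<Otimes>\<^sub>M revealed (range Batch))"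
    unfolding g_def split_beta'
  proof (intro borel_measurable_prod measurable_If factor_meas measurable_const)
    fix i
    have [measurable]: "(\<lambda>x. T i (fst x)) \<in> borel_measurable (revealed {Arrivals} \<Otimes>\<^sub>M revealed (range Batch))"
      by (rule measurable_compose[OF measurable_fst T_meas])
    show "{x \<in> space (revealed {Arrivals} \<Otimes>\<^sub>M revealed (range Batch)). T i (fst x) \<le> ereal t}
        \<in> sets (revealed {Arrivals} \<Otimes>\<^sub>M revealed (range Batch))" by measurable
  qed auto
  have g_bounds: "0 \<le> g i \<omega> \<omega>' \<and> g i \<omega> \<omega>' \<le> 1" for i \<omega> \<omega>'
    using b by (auto simp: g_def power_le_one intro!: prod_nonneg prod_le_1)
  then have bound: "\<bar>\<Prod>i<m. g i \<omega> \<omega>'\<bar> \<le> 1" for \<omega> \<omega>'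
    unfolding abs_prod by (intro prod_le_1) auto
  have "indep_var (revealed {Arrivals}) (\<lambda>\<omega>. \<omega>) (revealed (range Batch)) (\<lambda>\<omega>. \<omega>)"
    by (rule indep_revealed) auto
  from indep_var_expectation_fubini[OF this meas bound]
  have "expectation (\<lambda>\<omega>. \<Prod>i<m. g i \<omega> \<omega>)
      = expectation (\<lambda>\<omega>. expectation (\<lambda>\<omega>'. \<Prod>i<m. g i \<omega> \<omega>'))" .
  moreover have "expectation (\<lambda>\<omega>'. \<Prod>i<m. g i \<omega> \<omega>')
      = (\<Prod>i<m. if T i \<omega> \<le> ereal t then batch_transform z (age t i \<omega>) else 1)" for \<omega>
  proof -
    have source: "g i \<omega> \<in> borel_measurable (source_algebra M J T Sig X (Batch i))" for i
    proof (cases "T i \<omega> \<le> ereal t")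
      case True
      have "(\<lambda>\<omega>'. \<Prod>j=1..J. mean_mark z j (age t i \<omega>) ^ Sig i j \<omega>')
          \<in> borel_measurable (source_algebra M J T Sig X (Batch i))"
        by (intro borel_measurable_prod measurable_compose[OF batch_size_measurable]) auto
      then show ?thesis using True by (simp add: g_def[abs_def])
    qed (simp add: g_def[abs_def])
    have "indep_vars (\<lambda>_. borel) (\<lambda>i. g i \<omega>) {..<m}"
      by (rule indep_vars_sources[where f = Batch, OF _ _ source]) (auto simp: inj_on_def)
    then have "expectation (\<lambda>\<omega>'. \<Prod>i<m. g i \<omega> \<omega>') = (\<Prod>i<m. expectation (g i \<omega>))"
    proof (intro indep_vars_lebesgue_integral)
      show "integrable M (g i \<omega>)" for i
        by (rule integrable_const_bound[where B = 1])
           (use g_bounds measurable_from_source[OF _ source[of i]] in auto)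
    qed auto
    also have "\<dots> = (\<Prod>i<m. if T i \<omega> \<le> ereal t then batch_transform z (age t i \<omega>) else 1)"
    proof (intro prod.cong refl)
      fix i
      show "expectation (g i \<omega>) = (if T i \<omega> \<le> ereal t then batch_transform z (age t i \<omega>) else 1)"
        using expectation_batch_power[of "\<lambda>j. mean_mark z j (age t i \<omega>)" i] b
        by (simp add: g_def[abs_def] batch_transform_def prob_space)
    qed
    finally show ?thesis .
  qed
  ultimately show ?thesis by (simp add: g_def)
qed

lemma product_over_arrivals_limit:
  fixes w :: "nat \<Rightarrow> real"
  assumes "finite {i. T i \<omega> \<le> ereal t}"
  shows "(\<lambda>m. \<Prod>i<m. if T i \<omega> \<le> ereal t then w i else 1) \<longlonglongrightarrow> (\<Prod>i | T i \<omega> \<le> ereal t. w i)"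
proof -
  obtain r where r: "{i. T i \<omega> \<le> ereal t} \<subseteq> {..<r}"
    using finite_nat_iff_bounded assms by blast
  have "(\<Prod>i<m. if T i \<omega> \<le> ereal t then w i else 1) = (\<Prod>i | T i \<omega> \<le> ereal t. w i)" if "r \<le> m" for m
  proof -
    have "{i \<in> {..<m}. T i \<omega> \<le> ereal t} = {i. T i \<omega> \<le> ereal t}" using r that by fastforce
    then show ?thesis by (simp add: prod.inter_filter[symmetric])
  qed
  then show ?thesis
    by (intro tendsto_eventually) (auto simp: eventually_sequentially)
qed

text \<open>
  Sorting the customers by their queues instead of their batches.
\<close>

lemma product_of_marks:
  assumes t: "0 \<le> t" and fin: "finite {i. T i \<omega> \<le> ereal t}"
  shows "(\<Prod>i | T i \<omega> \<le> ereal t. \<Prod>j=1..J. \<Prod>l<Sig i j \<omega>. mark z (X i j l (age t i \<omega>) \<omega>))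
    = (\<Prod>k=1..J. z k ^ queue_length J T Sig X k t \<omega>)"
proof -
  define A where "A = (SIGMA i:{i. T i \<omega> \<le> ereal t}. SIGMA j:{1..J}. {..<Sig i j \<omega>})"
  define pos where "pos = (\<lambda>(i, j, l). X i j l (age t i \<omega>) \<omega>)"
  have A: "finite A" unfolding A_def by (intro finite_SigmaI fin) auto
  have "queue_length J T Sig X k t \<omega> = card {x \<in> A. pos x = k}" for k
  proof -
    have "{(i, j, l). T i \<omega> \<le> ereal t \<and> j \<in> {1..J} \<and> l < Sig i j \<omega> \<and>
        X i j l (t - real_of_ereal (T i \<omega>)) \<omega> = k} = {x \<in> A. pos x = k}"
      using t by (auto simp: A_def pos_def age_eq)
    then show ?thesis by (simp add: queue_length_def)
  qed
  then have "(\<Prod>k=1..J. z k ^ queue_length J T Sig X k t \<omega>)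
      = (\<Prod>k=1..J. \<Prod>x\<in>A. if pos x = k then z k else 1)"
    by (simp add: power_card_eq_prod[OF A])
  also have "\<dots> = (\<Prod>x\<in>A. \<Prod>k=1..J. if pos x = k then z k else 1)"
    by (rule prod.swap)
  also have "\<dots> = (\<Prod>x\<in>A. mark z (pos x))"
    by (simp add: mark_def)
  also have "\<dots> = (\<Prod>i | T i \<omega> \<le> ereal t. \<Prod>j=1..J. \<Prod>l<Sig i j \<omega>. mark z (X i j l (age t i \<omega>) \<omega>))"
    unfolding A_def pos_def by (simp add: prod.Sigma fin split_beta')
  finally show ?thesis ..
qed

text \<open>
  The number of batches up to \<open>t\<close> is random, so the two conditioning steps are applied to the first \<open>m\<close>
  batches, and \<open>m \<rightarrow> \<infinity>\<close>. What remains is a product over the Poisson points of a function of the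
  time of the point.
\<close>

theorem queue_lengths_pgf:
  assumes t: "0 \<le> t" and z: "unit_marks z"
  shows "expectation (\<lambda>\<omega>. \<Prod>k=1..J. z k ^ queue_length J T Sig X k t \<omega>)
    = exp (LINT \<tau>:{0<..t}|lborel. lam \<tau> * (batch_transform z (t - \<tau>) - 1))"
proof -
  define g where "g \<tau> = batch_transform z (max 0 (t - \<tau>))" for \<tau>
  have g_meas [measurable]: "g \<in> borel_measurable borel"
    unfolding g_def[abs_def] by (rule measurable_compose[OF _ batch_transform_measurable]) measurable
  have g_bounds: "0 \<le> g x" "g x \<le> 1" for x
    using batch_transform_bounds[OF z] by (auto simp: g_def)
  have mark01: "0 \<le> mark z x" "mark z x \<le> 1" for x
    using mark_bounds[of z] z by (auto simp: unit_marks_def)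
  define W where "W m \<omega> = (\<Prod>i<m. if T i \<omega> \<le> ereal t
      then \<Prod>j=1..J. \<Prod>l<Sig i j \<omega>. mark z (X i j l (age t i \<omega>) \<omega>) else 1)" for m \<omega>
  define V where "V m \<omega> = (\<Prod>i<m. if T i \<omega> \<le> ereal t then g (real_of_ereal (T i \<omega>)) else 1)" for m \<omega>
  have V_meas [measurable]: "V m \<in> borel_measurable M" for m
    unfolding V_def[abs_def] by measurable
  have W_meas [measurable]: "W m \<in> borel_measurable M" for m
    unfolding W_def[abs_def]
  proof (intro borel_measurable_prod measurable_If measurable_const)
    fix i j assume j: "j \<in> {1..J}"
    show "(\<lambda>\<omega>. \<Prod>l<Sig i j \<omega>. mark z (X i j l (age t i \<omega>) \<omega>)) \<in> borel_measurable M"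
      by (rule measurable_compose_countable[OF _ batch_measurable[OF j]])
         (intro borel_measurable_prod measurable_compose[OF position_measurable_at_age[OF j], of "mark z"], simp)
  qed measurable
  have W_bounds: "\<bar>W m \<omega>\<bar> \<le> 1" for m \<omega>
    unfolding W_def abs_prod using mark01
    by (intro prod_le_1) (auto simp: abs_prod intro!: prod_nonneg prod_le_1)
  have V_bounds: "\<bar>V m \<omega>\<bar> \<le> 1" for m \<omega>
    unfolding V_def abs_prod using g_bounds by (intro prod_le_1) auto
  have "V m = (\<lambda>\<omega>. \<Prod>i<m. if T i \<omega> \<le> ereal t then batch_transform z (age t i \<omega>) else 1)" for m
    unfolding V_def[abs_def] g_def age_def ..
  then have VW: "expectation (W m) = expectation (V m)" for m
    using expectation_given_arrivals_and_batches[OF t z, of m] expectation_given_arrivals[OF t z, of m]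
    by (simp add: W_def[abs_def])
  have "(\<lambda>m. expectation (W m)) \<longlonglongrightarrow> expectation (\<lambda>\<omega>. \<Prod>k=1..J. z k ^ queue_length J T Sig X k t \<omega>)"
  proof (rule integral_dominated_convergence[where w = "\<lambda>_. 1"])
    show "AE \<omega> in M. (\<lambda>m. W m \<omega>) \<longlonglongrightarrow> (\<Prod>k=1..J. z k ^ queue_length J T Sig X k t \<omega>)"
      using AE_finitely_many_positive_arrivals
    proof eventually_elim
      case (elim \<omega>)
      then have fin: "finite {i. T i \<omega> \<le> ereal t}" by blast
      show ?case
        unfolding W_def product_of_marks[OF t fin, symmetric] by (rule product_over_arrivals_limit[OF fin])
    qed
    show "(\<lambda>\<omega>. \<Prod>k=1..J. z k ^ queue_length J T Sig X k t \<omega>) \<in> borel_measurable M"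
      by (intro borel_measurable_prod measurable_compose[OF queue_length_measurable[OF t]]) simp
  qed (use W_bounds in auto)
  moreover have "(\<lambda>m. expectation (V m)) \<longlonglongrightarrow> expectation (arrival_product g t)"
  proof (rule integral_dominated_convergence[where w = "\<lambda>_. 1"])
    show "AE \<omega> in M. (\<lambda>m. V m \<omega>) \<longlonglongrightarrow> arrival_product g t \<omega>"
      using AE_finitely_many_positive_arrivals
    proof eventually_elim
      case (elim \<omega>)
      then have fin: "finite {i. T i \<omega> \<le> ereal t}" by blast
      show ?case
        unfolding V_def arrival_product_def by (rule product_over_arrivals_limit[OF fin])
    qed
  qed (use V_bounds in auto)
  ultimately have "expectation (\<lambda>\<omega>. \<Prod>k=1..J. z k ^ queue_length J T Sig X k t \<omega>)
      = expectation (arrival_product g t)"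
    unfolding VW by (rule LIMSEQ_unique)
  also have "\<dots> = exp (LINT \<tau>:{0<..t}|lborel. lam \<tau> * (g \<tau> - 1))"
    by (rule poisson_product_functional[OF t g_meas g_bounds])
  also have "(LINT \<tau>:{0<..t}|lborel. lam \<tau> * (g \<tau> - 1))
      = (LINT \<tau>:{0<..t}|lborel. lam \<tau> * (batch_transform z (t - \<tau>) - 1))"
    by (rule set_lebesgue_integral_cong) (auto simp: g_def)
  finally show ?thesis .
qed

end

section \<open>Binomial batches\<close>

lemma pgf_binomial:
  assumes "0 \<le> \<alpha>" "\<alpha> \<le> 1"
  shows "pgf (binomial_pmf N \<alpha>) z = (1 - \<alpha> + \<alpha> * z) ^ N"
proof -
  have "pgf (binomial_pmf N \<alpha>) z = (\<Sum>k\<le>N. of_nat (N choose k) * (\<alpha> * z) ^ k * (1 - \<alpha>) ^ (N - k))"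
    unfolding pgf_def using assms
    by (subst expectation_binomial_pmf') (auto simp: power_mult_distrib intro!: sum.cong)
  also have "\<dots> = (\<alpha> * z + (1 - \<alpha>)) ^ N" by (rule binomial_ring[symmetric])
  finally show ?thesis by (simp add: add.commute)
qed

text \<open>
  A single point is a null set. For a function that is not integrable, both sides are \<open>0\<close>.
\<close>

lemma set_integral_Icc_eq_Ioc:
  fixes f :: "real \<Rightarrow> real"
  shows "(LINT \<tau>:{a..b}|lborel. f \<tau>) = (LINT \<tau>:{a<..b}|lborel. f \<tau>)"
  unfolding set_lebesgue_integral_def
  by (rule integral_discrete_difference[where X = "{a}"]) (auto simp: indicator_def)

context batch_network
begin

text \<open>
  For \<open>\<Sum> i \<le> N\<close> and \<open>v \<le> J\<close> this is a multinomial probability: each of the \<open>N\<close> potential customers of a batch of age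
  \<open>u\<close> is independently in queue \<open>k\<close> with probability \<open>\<alpha> q\<^sub>k(u)\<close>; exactly \<open>i k\<close> of them are in queue \<open>k\<close> for
  each \<open>k \<le> v\<close>, and the others are in no queue at all.
\<close>

definition contribution :: "nat \<Rightarrow> real \<Rightarrow> nat \<Rightarrow> (nat \<Rightarrow> nat) \<Rightarrow> real \<Rightarrow> real" where
  "contribution N \<alpha> v i u = (fact N / fact (N - (\<Sum>k=1..v. i k)))
    * (1 - \<alpha> * (\<Sum>k=1..J. occupancy J p q k u)) ^ (N - (\<Sum>k=1..v. i k))
    * (\<Prod>k=1..v. (\<alpha> * occupancy J p q k u) ^ i k / fact (i k))"

lemma position_prob_bounds:
  assumes "j \<in> {1..J}" "k \<in> {1..J}" "0 \<le> u"
  shows "0 \<le> q j k u" "q j k u \<le> 1"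
  using position_prob[OF assms, of 0 0, symmetric] by auto

lemma occupancy_bounds:
  assumes "k \<in> {1..J}" "0 \<le> u"
  shows "0 \<le> occupancy J p q k u" "occupancy J p q k u \<le> 1"
  unfolding occupancy_def
  by (rule entry_average_bounds; use position_prob_bounds[OF _ assms] in simp)+

lemma occupancy_measurable:
  assumes "k \<in> {1..J}"
  shows "(\<lambda>u. occupancy J p q k (max 0 u)) \<in> borel_measurable borel"
proof -
  have "(\<lambda>u. q j k (max 0 u)) \<in> borel_measurable borel" if "j \<in> {1..J}" for j
  proof -
    have "(\<lambda>u. indicator {0..} u * q j k u) \<in> borel_measurable borel"
      using position_prob_measurable[OF that assms] by (simp add: set_borel_measurable_def)
    from measurable_compose[OF _ this, of "max 0" borel]
    show ?thesis by simp
  qed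
  then show ?thesis
    unfolding occupancy_def by (intro borel_measurable_sum borel_measurable_times) auto
qed

text \<open>
  The contribution is measurable only in nonnegative ages, hence the detour through \<open>max 0 (t - \<tau>)\<close>. The
  crude bound \<open>1 + J\<close> for the base of the power suffices.
\<close>

lemma contribution_integrable:
  assumes t: "0 \<le> t" and v: "v \<le> J" and \<alpha>: "0 \<le> \<alpha>" "\<alpha> \<le> 1"
  shows "set_integrable lborel {0<..t} (\<lambda>\<tau>. lam \<tau> * contribution N \<alpha> v i (t - \<tau>))"
proof -
  define R where "R = N - (\<Sum>k=1..v. i k)"
  have occ: "0 \<le> \<alpha> * occupancy J p q k u \<and> \<alpha> * occupancy J p q k u \<le> 1"
    if "k \<in> {1..J}" "0 \<le> u" for k u
    using occupancy_bounds[OF that] \<alpha> by (auto intro: mult_le_one)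
  have "set_integrable lborel {0<..t} (\<lambda>\<tau>. lam \<tau> * contribution N \<alpha> v i (max 0 (t - \<tau>)))"
  proof (rule rate_times_bounded_integrable)
    show "{0<..t} \<subseteq> {0..t}" by auto
    show "(\<lambda>\<tau>. contribution N \<alpha> v i (max 0 (t - \<tau>))) \<in> borel_measurable borel"
      unfolding contribution_def
      by (intro borel_measurable_times borel_measurable_prod borel_measurable_power borel_measurable_diff
          borel_measurable_divide borel_measurable_sum borel_measurable_const
          measurable_compose[OF _ occupancy_measurable, of "\<lambda>\<tau>. t - \<tau>"]) (use v in auto)
    fix \<tau>
    define u where "u = max 0 (t - \<tau>)"
    have u: "0 \<le> u" by (simp add: u_def)
    have "0 \<le> \<alpha> * (\<Sum>k=1..J. occupancy J p q k u)" "\<alpha> * (\<Sum>k=1..J. occupancy J p q k u) \<le> real J"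
    proof -
      show "0 \<le> \<alpha> * (\<Sum>k=1..J. occupancy J p q k u)"
        unfolding sum_distrib_left using occ[OF _ u] by (intro sum_nonneg) auto
      show "\<alpha> * (\<Sum>k=1..J. occupancy J p q k u) \<le> real J"
        unfolding sum_distrib_left using sum_bounded_above[of "{1..J}" "\<lambda>k. \<alpha> * occupancy J p q k u" 1] occ[OF _ u]
        by auto
    qed
    then have "\<bar>1 - \<alpha> * (\<Sum>k=1..J. occupancy J p q k u)\<bar> \<le> 1 + real J" by linarith
    then have base: "\<bar>1 - \<alpha> * (\<Sum>k=1..J. occupancy J p q k u)\<bar> ^ R \<le> (1 + real J) ^ R"
      by (rule power_mono) simp
    have "(\<alpha> * occupancy J p q k u) ^ i k / fact (i k) \<le> 1" "0 \<le> (\<alpha> * occupancy J p q k u) ^ i k / fact (i k)"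
      if "k \<in> {1..v}" for k
    proof -
      have k: "k \<in> {1..J}" using that v by auto
      have "(\<alpha> * occupancy J p q k u) ^ i k \<le> 1" using occ[OF k u] by (intro power_le_one) auto
      also have "1 \<le> (fact (i k) :: real)" by (rule fact_ge_1)
      finally show "(\<alpha> * occupancy J p q k u) ^ i k / fact (i k) \<le> 1" by simp
      show "0 \<le> (\<alpha> * occupancy J p q k u) ^ i k / fact (i k)" using occ[OF k u] by simp
    qed
    then have prod: "\<bar>\<Prod>k=1..v. (\<alpha> * occupancy J p q k u) ^ i k / fact (i k)\<bar> \<le> 1"
      unfolding abs_prod by (intro prod_le_1) (auto simp del: abs_divide)
    have "\<bar>contribution N \<alpha> v i u\<bar> \<le> (fact N / fact R) * (1 + real J) ^ R * 1"
      unfolding contribution_def R_def[symmetric] abs_mult power_abs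
      by (intro mult_mono prod base) auto
    then show "\<bar>contribution N \<alpha> v i (max 0 (t - \<tau>))\<bar> \<le> (fact N / fact R) * (1 + real J) ^ R * 1"
      by (simp only: u_def)
  qed simp
  then show ?thesis
    by (rule set_integrable_cong[THEN iffD1, rotated -1]) auto
qed

text \<open>
  Averaged over the entry queue, the mark of a customer is \<open>1 - \<Sum>\<^sub>k q\<^sub>k(u) (1 - z\<^sub>k)\<close>. Inserting this in
  \<open>(1 - \<alpha> + \<alpha> x)\<^sup>N\<close> gives the \<open>N\<close>-th power of \<open>(1 - \<alpha> \<Sum>\<^sub>k q\<^sub>k(u)) + \<Sum>\<^sub>k \<alpha> q\<^sub>k(u) z\<^sub>k\<close>.
\<close>

lemma batch_transform_binomial:
  assumes B: "B = binomial_pmf N \<alpha>" "0 \<le> \<alpha>" "\<alpha> \<le> 1" and v: "v \<le> J" and u: "0 \<le> u"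
    and z: "\<And>k. v < k \<Longrightarrow> z k = 0"
  shows "batch_transform z u = (\<Sum>i\<in>PiE {1..v} (\<lambda>_. {0..N}).
    of_bool (sum i {1..v} \<le> N) * (contribution N \<alpha> v i u * (\<Prod>k=1..v. z k ^ i k)))"
proof -
  have "(\<Sum>j=1..J. p j * mean_mark z j u)
      = (\<Sum>j=1..J. p j) - (\<Sum>j=1..J. \<Sum>k=1..J. p j * q j k u * (1 - z k))"
    using u by (simp add: mean_mark_def right_diff_distrib sum_subtractf sum_distrib_left mult.assoc)
  also have "(\<Sum>j=1..J. \<Sum>k=1..J. p j * q j k u * (1 - z k))
      = (\<Sum>k=1..J. occupancy J p q k u * (1 - z k))"
    by (subst sum.swap) (simp add: occupancy_def sum_distrib_right)
  finally have avg: "(\<Sum>j=1..J. p j * mean_mark z j u) = 1 - (\<Sum>k=1..J. occupancy J p q k u * (1 - z k))"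
    unfolding entry_prob_sum .
  have "(\<Sum>k=1..J. occupancy J p q k u * z k) = (\<Sum>k=1..v. occupancy J p q k u * z k)"
    using v z by (intro sum.mono_neutral_right) auto
  then have "1 - \<alpha> + \<alpha> * (\<Sum>j=1..J. p j * mean_mark z j u)
      = 1 - \<alpha> * (\<Sum>k=1..J. occupancy J p q k u) + (\<Sum>k=1..v. \<alpha> * occupancy J p q k u * z k)"
    unfolding avg by (simp add: algebra_simps sum_subtractf sum_distrib_left)
  moreover have "batch_transform z u = (1 - \<alpha> + \<alpha> * (\<Sum>j=1..J. p j * mean_mark z j u)) ^ N"
    using pgf_binomial[OF B(2,3)] B(1) by (metis batch_transform_def)
  ultimately have "batch_transform z u = (1 - \<alpha> * (\<Sum>k=1..J. occupancy J p q k u)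
      + (\<Sum>k=1..v. \<alpha> * occupancy J p q k u * z k)) ^ N"
    by (simp only:)
  also have "\<dots> = (\<Sum>i\<in>PiE {1..v} (\<lambda>_. {0..N}).
    of_bool (sum i {1..v} \<le> N) * (contribution N \<alpha> v i u * (\<Prod>k=1..v. z k ^ i k)))"
    by (subst multinomial_power_expansion)
       (simp_all add: contribution_def power_mult_distrib prod.distrib mult_ac flip: times_divide_eq_left
          cong: sum.cong)
  finally show ?thesis .
qed

lemma log_pgf_expansion:
  assumes B: "B = binomial_pmf N \<alpha>" "0 \<le> \<alpha>" "\<alpha> \<le> 1" and t: "0 \<le> t" and v: "v \<le> J"
    and z: "\<And>k. v < k \<Longrightarrow> z k = 0"
  shows "(LINT \<tau>:{0<..t}|lborel. lam \<tau> * (batch_transform z (t - \<tau>) - 1))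
    = - (LINT \<tau>:{0<..t}|lborel. lam \<tau>) + (\<Sum>i\<in>PiE {1..v} (\<lambda>_. {0..N}).
        of_bool (sum i {1..v} \<le> N) * (LINT \<tau>:{0<..t}|lborel. lam \<tau> * contribution N \<alpha> v i (t - \<tau>))
        * (\<Prod>k=1..v. z k ^ i k))"
proof -
  let ?I = "PiE {1..v} (\<lambda>_. {0..N})"
  define w where "w i = of_bool (sum i {1..v} \<le> N) * (\<Prod>k=1..v. z k ^ i k)" for i
  have int: "integrable lborel (\<lambda>\<tau>. indicator {0<..t} \<tau> * (lam \<tau> * contribution N \<alpha> v i (t - \<tau>)))" for i
    using contribution_integrable[OF t v B(2,3)] by (simp add: set_integrable_def)
  have lam: "integrable lborel (\<lambda>\<tau>. indicator {0<..t} \<tau> * lam \<tau>)"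
  proof -
    have "set_integrable lborel {0<..t} lam" by (rule rate_set_integrable[of _ t]) auto
    then show ?thesis by (simp add: set_integrable_def)
  qed
  have "indicator {0<..t} \<tau> * (lam \<tau> * (batch_transform z (t - \<tau>) - 1))
      = (\<Sum>i\<in>?I. w i * (indicator {0<..t} \<tau> * (lam \<tau> * contribution N \<alpha> v i (t - \<tau>))))
        - indicator {0<..t} \<tau> * lam \<tau>" for \<tau>
  proof (cases "\<tau> \<in> {0<..t}")
    case True
    then have "0 \<le> t - \<tau>" by simp
    from batch_transform_binomial[OF B v this z]
    have "batch_transform z (t - \<tau>) = (\<Sum>i\<in>?I. w i * contribution N \<alpha> v i (t - \<tau>))"
      by (simp add: w_def mult_ac)
    then show ?thesis using True by (simp add: algebra_simps sum_distrib_left)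
  qed simp
  then have "(LINT \<tau>:{0<..t}|lborel. lam \<tau> * (batch_transform z (t - \<tau>) - 1))
      = (LINT \<tau>|lborel. (\<Sum>i\<in>?I. w i * (indicator {0<..t} \<tau> * (lam \<tau> * contribution N \<alpha> v i (t - \<tau>))))
        - indicator {0<..t} \<tau> * lam \<tau>)"
    by (simp add: set_lebesgue_integral_def)
  also have "\<dots> = (\<Sum>i\<in>?I. w i * (LINT \<tau>:{0<..t}|lborel. lam \<tau> * contribution N \<alpha> v i (t - \<tau>)))
      - (LINT \<tau>:{0<..t}|lborel. lam \<tau>)"
    using int lam by (simp add: set_lebesgue_integral_def)
  finally show ?thesis by (simp add: w_def mult_ac)
qed

text \<open>
  Writing the state \<open>n - i\<close> as the event \<open>N + i = n\<close> avoids truncated subtraction: the event is empty when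
  some \<open>i k\<close> exceeds \<open>n k\<close>.
\<close>

lemma expectation_shifted_state:
  assumes t: "0 \<le> t" and v: "1 \<le> v" "v \<le> J"
  shows "expectation (\<lambda>\<omega>. of_bool (\<forall>k\<in>{v<..J}. queue_length J T Sig X k t \<omega> = 0) *
      of_bool (queue_length J T Sig X v t \<omega> + i v = n v) *
      of_bool (\<forall>k\<in>{1..<v}. queue_length J T Sig X k t \<omega> + i k = n k))
    = (if \<forall>k\<in>{1..v}. i k \<le> n k then state_prob M J T Sig X t (zero_beyond v (\<lambda>k. n k - i k)) else 0)"
proof -
  let ?Q = "\<lambda>k \<omega>. queue_length J T Sig X k t \<omega>"
  let ?E = "{\<omega> \<in> space M. \<forall>k\<in>{1..J}. ?Q k \<omega> = zero_beyond v (\<lambda>k. n k - i k) k}"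
  have split: "(\<forall>k\<in>{1..J}. P k) \<longleftrightarrow> (\<forall>k\<in>{v<..J}. P k) \<and> P v \<and> (\<forall>k\<in>{1..<v}. P k)" for P
  proof -
    have "{1..J} = {v<..J} \<union> {v} \<union> {1..<v}" using v by auto
    then show ?thesis by blast
  qed
  show ?thesis
  proof (cases "\<forall>k\<in>{1..v}. i k \<le> n k")
    case True
    then have le: "i v \<le> n v" "\<And>k. k \<in> {1..<v} \<Longrightarrow> i k \<le> n k" using v by auto
    have "expectation (\<lambda>\<omega>. of_bool (\<forall>k\<in>{v<..J}. ?Q k \<omega> = 0) * of_bool (?Q v \<omega> + i v = n v) *
        of_bool (\<forall>k\<in>{1..<v}. ?Q k \<omega> + i k = n k)) = expectation (indicator ?E :: 'w \<Rightarrow> real)"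
    proof (rule Bochner_Integration.integral_cong[OF refl])
      fix \<omega> assume \<omega>: "\<omega> \<in> space M"
      have "?Q v \<omega> + i v = n v \<longleftrightarrow> ?Q v \<omega> = n v - i v" using le(1) by auto
      moreover have "(\<forall>k\<in>{1..<v}. ?Q k \<omega> + i k = n k) \<longleftrightarrow> (\<forall>k\<in>{1..<v}. ?Q k \<omega> = n k - i k)"
        using le(2) by (intro ball_cong refl) fastforce
      ultimately have "\<omega> \<in> ?E \<longleftrightarrow> (\<forall>k\<in>{v<..J}. ?Q k \<omega> = 0) \<and> ?Q v \<omega> + i v = n v \<and>
          (\<forall>k\<in>{1..<v}. ?Q k \<omega> + i k = n k)"
        using \<omega> unfolding split by (simp add: zero_beyond_def)
      then show "of_bool (\<forall>k\<in>{v<..J}. ?Q k \<omega> = 0) * of_bool (?Q v \<omega> + i v = n v) *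
        of_bool (\<forall>k\<in>{1..<v}. ?Q k \<omega> + i k = n k) = (indicator ?E \<omega> :: real)"
        by (simp add: indicator_def flip: of_bool_conj)
    qed
    also have "\<dots> = prob ?E"
    proof -
      have "?E \<inter> space M = ?E" by blast
      then show ?thesis by simp
    qed
    finally show ?thesis using True by (simp add: state_prob_def)
  next
    case False
    then obtain k where k: "k \<in> {1..v}" "n k < i k" by (auto simp: not_le)
    have zero: "of_bool (\<forall>k\<in>{v<..J}. ?Q k \<omega> = 0) * of_bool (?Q v \<omega> + i v = n v) *
        of_bool (\<forall>k\<in>{1..<v}. ?Q k \<omega> + i k = n k) = (0::real)" for \<omega>
    proof (cases "k = v")
      case False
      then have "k \<in> {1..<v}" "?Q k \<omega> + i k \<noteq> n k" using k by auto
      then show ?thesis by auto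
    qed (use k in auto)
    show ?thesis unfolding zero if_not_P[OF False] by simp
  qed
qed

text \<open>
  The recursion before division by \<open>n v\<close>, with \<open>i\<close> ranging over all possible contributions of a batch to
  the first \<open>v\<close> queues. Terms with \<open>i v = 0\<close> vanish, because differentiation in \<open>z\<^sub>v\<close> removes them.
\<close>

theorem binomial_state_recursion:
  assumes B: "B = binomial_pmf N \<alpha>" "0 \<le> \<alpha>" "\<alpha> \<le> 1" and t: "0 \<le> t" and v: "1 \<le> v" "v \<le> J"
  shows "real (n v) * state_prob M J T Sig X t (zero_beyond v n) =
    (\<Sum>i\<in>PiE {1..v} (\<lambda>_. {0..N}). real (i v)
      * (of_bool (sum i {1..v} \<le> N) * (LINT \<tau>:{0<..t}|lborel. lam \<tau> * contribution N \<alpha> v i (t - \<tau>)))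
      * (if \<forall>k\<in>{1..v}. i k \<le> n k then state_prob M J T Sig X t (zero_beyond v (\<lambda>k. n k - i k)) else 0))"
proof -
  let ?I = "PiE {1..v} (\<lambda>_. {0..N})"
  let ?Q = "\<lambda>k \<omega>. queue_length J T Sig X k t \<omega>"
  define c where "c i = of_bool (sum i {1..v} \<le> N) *
    (LINT \<tau>:{0<..t}|lborel. lam \<tau> * contribution N \<alpha> v i (t - \<tau>))" for i
  define tail :: "'w \<Rightarrow> real" where "tail \<omega> = of_bool (\<forall>k\<in>{v<..J}. ?Q k \<omega> = 0)" for \<omega>
  note [measurable] = queue_length_measurable[OF t]
  have [measurable]: "tail \<in> borel_measurable M" unfolding tail_def[abs_def] by measurable
  have tail01: "0 \<le> tail \<omega>" "tail \<omega> \<le> 1" for \<omega> by (auto simp: tail_def)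
  have finI: "finite ?I" by (intro finite_PiE) auto
  \<comment> \<open>The coefficient of \<open>z\<^sub>v\<close> to the power \<open>n v\<close>, with the marks of the queues below \<open>v\<close> still free.\<close>
  have one_variable: "real (n v) * expectation (\<lambda>\<omega>. tail \<omega> * (\<Prod>k\<in>{1..<v}. z k ^ ?Q k \<omega>) * of_bool (?Q v \<omega> = n v))
      = (\<Sum>i\<in>?I. real (i v) * c i * expectation (\<lambda>\<omega>. tail \<omega> *
          of_bool (?Q v \<omega> + i v = n v) * (\<Prod>k\<in>{1..<v}. z k ^ (?Q k \<omega> + i k))))"
    if z: "\<And>k. 0 \<le> z k \<and> z k \<le> 1" for z
  proof -
    define Z where "Z \<omega> = tail \<omega> * (\<Prod>k\<in>{1..<v}. z k ^ ?Q k \<omega>)" for \<omega>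
    have Z: "integrable M Z"
    proof (rule integrable_const_bound[where B = 1])
      have "0 \<le> (\<Prod>k\<in>{1..<v}. z k ^ ?Q k \<omega>)" "(\<Prod>k\<in>{1..<v}. z k ^ ?Q k \<omega>) \<le> 1" for \<omega>
        using z by (auto intro!: prod_nonneg prod_le_1 simp: power_le_one)
      then show "AE \<omega> in M. norm (Z \<omega>) \<le> 1"
        using tail01 by (auto simp: Z_def abs_mult intro!: mult_le_one)
      show "Z \<in> borel_measurable M" unfolding Z_def[abs_def] by measurable
    qed
    define a where "a m = expectation (\<lambda>\<omega>. Z \<omega> * of_bool (?Q v \<omega> = m))" for m
    define d where "d i = c i * (\<Prod>k\<in>{1..<v}. z k ^ i k)" for i
    have series: "(\<lambda>m. a m * x ^ m) sums
        exp (- (LINT \<tau>:{0<..t}|lborel. lam \<tau>) + (\<Sum>i\<in>?I. d i * x ^ i v))" if x: "0 \<le> x" "x < 1" for x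
    proof -
      \<comment> \<open>As \<open>0\<^sup>0 = 1\<close>, a zero mark on the queues beyond \<open>v\<close> is the indicator that they are empty.\<close>
      define y where "y k = (if k = v then x else if k < v then z k else 0)" for k
      have upto_v: "(\<Prod>k=1..v. y k ^ r k) = (\<Prod>k\<in>{1..<v}. z k ^ r k) * x ^ r v" for r
      proof -
        have "{1..v} = insert v {1..<v}" using v by auto
        moreover have "(\<Prod>k\<in>{1..<v}. y k ^ r k) = (\<Prod>k\<in>{1..<v}. z k ^ r k)"
          by (rule prod.cong) (auto simp: y_def)
        ultimately show ?thesis by (simp add: y_def mult.commute)
      qed
      have marks: "(\<Prod>k=1..J. y k ^ ?Q k \<omega>) = Z \<omega> * x ^ ?Q v \<omega>" for \<omega>
      proof -
        have "(\<Prod>k\<in>{v<..J}. y k ^ ?Q k \<omega>) = tail \<omega>"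
        proof -
          have "(\<Prod>k\<in>{v<..J}. y k ^ ?Q k \<omega>) = (\<Prod>k\<in>{v<..J}. of_bool (?Q k \<omega> = 0))"
            by (rule prod.cong) (auto simp: y_def power_0_left)
          also have "\<dots> = tail \<omega>"
            by (auto simp: tail_def)
          finally show ?thesis .
        qed
        moreover have "(\<Prod>k=1..J. y k ^ ?Q k \<omega>) = (\<Prod>k=1..v. y k ^ ?Q k \<omega>) * (\<Prod>k\<in>{v<..J}. y k ^ ?Q k \<omega>)"
        proof -
          have union: "{1..J} = {1..v} \<union> {v<..J}" using v by auto
          show ?thesis unfolding union by (rule prod.union_disjoint) auto
        qed
        ultimately show ?thesis using upto_v[of "\<lambda>k. ?Q k \<omega>"] by (simp add: Z_def)
      qed
      have "expectation (\<lambda>\<omega>. Z \<omega> * x ^ ?Q v \<omega>)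
          = exp (LINT \<tau>:{0<..t}|lborel. lam \<tau> * (batch_transform y (t - \<tau>) - 1))"
        unfolding marks[symmetric]
        by (rule queue_lengths_pgf[OF t]) (use z x in \<open>auto simp: unit_marks_def y_def\<close>)
      also have "(LINT \<tau>:{0<..t}|lborel. lam \<tau> * (batch_transform y (t - \<tau>) - 1))
          = - (LINT \<tau>:{0<..t}|lborel. lam \<tau>) + (\<Sum>i\<in>?I. d i * x ^ i v)"
      proof -
        have "(LINT \<tau>:{0<..t}|lborel. lam \<tau> * (batch_transform y (t - \<tau>) - 1))
            = - (LINT \<tau>:{0<..t}|lborel. lam \<tau>) + (\<Sum>i\<in>?I. c i * (\<Prod>k=1..v. y k ^ i k))"
          unfolding c_def by (rule log_pgf_expansion[OF B t v(2)]) (simp add: y_def)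
        then show ?thesis by (simp only: upto_v d_def mult.assoc)
      qed
      finally show ?thesis
        using weighted_pgf_sums[OF queue_length_measurable[OF t] Z, of x v] x by (simp add: a_def)
    qed
    have "real (n v) * a (n v) = (\<Sum>i\<in>?I. real (i v) * d i * (if i v \<le> n v then a (n v - i v) else 0))"
      by (rule exp_polynomial_recursion[OF finI series])
    also have "\<dots> = (\<Sum>i\<in>?I. real (i v) * c i * expectation (\<lambda>\<omega>. tail \<omega> *
          of_bool (?Q v \<omega> + i v = n v) * (\<Prod>k\<in>{1..<v}. z k ^ (?Q k \<omega> + i k))))"
    proof (rule sum.cong[OF refl])
      fix i
      have shifted: "(if i v \<le> n v then a (n v - i v) else 0)
          = expectation (\<lambda>\<omega>. Z \<omega> * of_bool (?Q v \<omega> + i v = n v))"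
      proof (cases "i v \<le> n v")
        case True
        then have "?Q v \<omega> + i v = n v \<longleftrightarrow> ?Q v \<omega> = n v - i v" for \<omega> by auto
        then show ?thesis using True by (simp add: a_def)
      qed auto
      have "(\<Prod>k\<in>{1..<v}. z k ^ i k) * expectation (\<lambda>\<omega>. Z \<omega> * of_bool (?Q v \<omega> + i v = n v))
          = expectation (\<lambda>\<omega>. (\<Prod>k\<in>{1..<v}. z k ^ i k) * (Z \<omega> * of_bool (?Q v \<omega> + i v = n v)))"
        by simp
      also have "\<dots> = expectation (\<lambda>\<omega>. tail \<omega> *
          of_bool (?Q v \<omega> + i v = n v) * (\<Prod>k\<in>{1..<v}. z k ^ (?Q k \<omega> + i k)))"
        by (simp add: Z_def power_add prod.distrib mult_ac)
      finally show "real (i v) * d i * (if i v \<le> n v then a (n v - i v) else 0)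
        = real (i v) * c i * expectation (\<lambda>\<omega>. tail \<omega> *
          of_bool (?Q v \<omega> + i v = n v) * (\<Prod>k\<in>{1..<v}. z k ^ (?Q k \<omega> + i k)))"
        unfolding shifted d_def by simp
    qed
    finally show ?thesis by (simp add: a_def Z_def)
  qed
  \<comment> \<open>The left side of the recursion and the terms on its right side form one family: \<open>None\<close> stands for
    the unshifted state, and \<open>Some i\<close> for the state shifted by \<open>i\<close>.\<close>
  define shift where "shift s k = (case s of None \<Rightarrow> 0 | Some i \<Rightarrow> i k)" for s :: "(nat \<Rightarrow> nat) option" and k
  define coef where "coef s = (case s of None \<Rightarrow> real (n v) | Some i \<Rightarrow> - (real (i v) * c i))" for s
  have "(\<Sum>s\<in>insert None (Some ` ?I). coef s * expectation (\<lambda>\<omega>.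
      (tail \<omega> * of_bool (?Q v \<omega> + shift s v = n v)) * of_bool (\<forall>k\<in>{1..<v}. ?Q k \<omega> + shift s k = n k))) = 0"
  proof (rule pgf_coefficient_identity)
    show "integrable M (\<lambda>\<omega>. tail \<omega> * of_bool (?Q v \<omega> + shift s v = n v))" for s
      by (rule integrable_const_bound[where B = 1]) (use tail01 in auto)
    fix z :: "nat \<Rightarrow> real" assume "\<And>k. 0 \<le> z k \<and> z k \<le> 1"
    from one_variable[of z, OF this]
    show "(\<Sum>s\<in>insert None (Some ` ?I). coef s * expectation (\<lambda>\<omega>.
        tail \<omega> * of_bool (?Q v \<omega> + shift s v = n v) * (\<Prod>k\<in>{1..<v}. z k ^ (?Q k \<omega> + shift s k)))) = 0"
      using finI by (simp add: sum.reindex coef_def shift_def sum_negf mult_ac)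
  qed (use finI in auto)
  then have "real (n v) * expectation (\<lambda>\<omega>.
      tail \<omega> * of_bool (?Q v \<omega> + 0 = n v) * of_bool (\<forall>k\<in>{1..<v}. ?Q k \<omega> + 0 = n k))
    = (\<Sum>i\<in>?I. real (i v) * c i * expectation (\<lambda>\<omega>.
      tail \<omega> * of_bool (?Q v \<omega> + i v = n v) * of_bool (\<forall>k\<in>{1..<v}. ?Q k \<omega> + i k = n k)))"
    using finI by (simp add: sum.reindex coef_def shift_def sum_negf)
  then show ?thesis
    unfolding tail_def expectation_shifted_state[OF t v]
      expectation_shifted_state[OF t v, of "\<lambda>_. 0"] by (simp add: c_def)
qed

end

theorem corollary5p1p1:
  fixes M :: "'w measure" and J N v :: nat and \<alpha> t :: real and n :: "nat \<Rightarrow> nat"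
    and lam :: "real \<Rightarrow> real" and T :: "nat \<Rightarrow> 'w \<Rightarrow> ereal"
    and Sig :: "nat \<Rightarrow> nat \<Rightarrow> 'w \<Rightarrow> nat"
    and X :: "nat \<Rightarrow> nat \<Rightarrow> nat \<Rightarrow> real \<Rightarrow> 'w \<Rightarrow> nat"
    and D :: "(nat \<Rightarrow> nat) measure" and B :: "nat pmf"
    and p :: "nat \<Rightarrow> real" and q :: "nat \<Rightarrow> nat \<Rightarrow> real \<Rightarrow> real"
  assumes "batch_network M J lam T Sig X D B p q"
    and "B = binomial_pmf N \<alpha>" and "1 \<le> N" and "0 \<le> \<alpha>" and "\<alpha> \<le> 1"
    and "0 \<le> t" and "v \<in> {2..J}" and "1 \<le> n v"
  shows "state_prob M J T Sig X t (zero_beyond v n) =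
    (\<Sum>i \<in> (\<Pi>\<^sub>E k\<in>{1..v}. if k = v then {1..n k} else {0..n k}).
       real (i v) / real (n v)
       * state_prob M J T Sig X t (zero_beyond v (\<lambda>k. n k - i k))
       * of_bool ((\<Sum>j=1..v. i j) \<le> N)
       * (LINT \<tau>:{0..t}|lborel.
            lam \<tau> * (fact N / fact (N - (\<Sum>k=1..v. i k)))
            * (1 - \<alpha> * (\<Sum>k=1..J. occupancy J p q k (t - \<tau>))) ^ (N - (\<Sum>k=1..v. i k))
            * (\<Prod>k=1..v. (\<alpha> * occupancy J p q k (t - \<tau>)) ^ i k / fact (i k))))"
    (is "?lhs = (\<Sum>i\<in>?Q. ?F i)")
proof -
  interpret batch_network M J lam T Sig X D B p q by fact
  let ?I = "PiE {1..v} (\<lambda>_. {0..N})"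
  define S where "S i = state_prob M J T Sig X t (zero_beyond v (\<lambda>k. n k - i k))" for i
  define L where "L i = (LINT \<tau>:{0<..t}|lborel. lam \<tau> * contribution N \<alpha> v i (t - \<tau>))" for i
  have v: "1 \<le> v" "v \<le> J" using assms(7) by auto
  have F: "?F i = real (i v) * (of_bool (sum i {1..v} \<le> N) * L i) * S i / real (n v)" for i
    unfolding set_integral_Icc_eq_Ioc L_def S_def contribution_def by (simp add: mult_ac)
  have "real (n v) * ?lhs = (\<Sum>i\<in>?I. real (i v) * (of_bool (sum i {1..v} \<le> N) * L i) *
      (if \<forall>k\<in>{1..v}. i k \<le> n k then S i else 0))"
    unfolding L_def S_def by (rule binomial_state_recursion) (use assms v in auto)
  also have "\<dots> = (\<Sum>i\<in>?Q. real (i v) * (of_bool (sum i {1..v} \<le> N) * L i) * S i)"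
  \<comment> \<open>A vector outside the intersection of the two index sets has total above \<open>N\<close>, or \<open>i v = 0\<close>, or
    exceeds \<open>n\<close> in some coordinate; its term is \<open>0\<close> in each case.\<close>
  proof (rule sum.mono_neutral_cong)
    show "finite ?I" "finite ?Q" by (auto intro!: finite_PiE)
    show "real (i v) * (of_bool (sum i {1..v} \<le> N) * L i) * S i = 0" if i: "i \<in> ?Q - ?I" for i
    proof -
      from i obtain k where k: "k \<in> {1..v}" "i k \<notin> {0..N}" by (auto simp: PiE_iff)
      then have "N < sum i {1..v}" using member_le_sum[of k "{1..v}" i] by auto
      then show ?thesis by simp
    qed
    show "real (i v) * (of_bool (sum i {1..v} \<le> N) * L i) *
      (if \<forall>k\<in>{1..v}. i k \<le> n k then S i else 0) = 0" if i: "i \<in> ?I - ?Q" for i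
    proof -
      from i obtain k where k: "k \<in> {1..v}" "i k \<notin> (if k = v then {1..n k} else {0..n k})"
        by (auto simp: PiE_iff)
      then have "i v = 0 \<or> \<not> i k \<le> n k" by (auto split: if_splits)
      then show ?thesis using k(1) by auto
    qed
    show "real (i v) * (of_bool (sum i {1..v} \<le> N) * L i) *
      (if \<forall>k\<in>{1..v}. i k \<le> n k then S i else 0)
      = real (i v) * (of_bool (sum i {1..v} \<le> N) * L i) * S i" if i: "i \<in> ?I \<inter> ?Q" for i
    proof -
      have "\<forall>k\<in>{1..v}. i k \<le> n k" using i by (force simp: PiE_iff split: if_splits)
      then show ?thesis by simp
    qed
  qed
  finally have "?lhs = (\<Sum>i\<in>?Q. real (i v) * (of_bool (sum i {1..v} \<le> N) * L i) * S i) / real (n v)"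
    using assms(8) by (simp add: field_simps)
  then show ?thesis unfolding F by (simp add: sum_divide_distrib)
qed

end
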